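(* Let $J:\mathbb{R}^N\setminus\{0\}\to[0,\infty)$ be radially symmetric, positive near the origin, and such that $\int_{\mathbb{R}^N}J(z)\min\{|z|^2,1\}\,dz<\infty$, and let $$m(\xi)=\int_{\mathbb{R}^N}\big(1-\cos(z\cdot\xi)\big)J(z)\,dz .$$ Assume that, for some $0<\gamma\le2$ and some $c_0>0$, $m(\xi)\ge c_0|\xi|^\gamma$ for all $|\xi|\le1$, and fix $r,s$ with $1<r<s\le2$. Then there is a constant $c>0$ such that for every nonzero $z\in\mathcal{H}_{\mathcal L}(\mathbb{R}^N)\cap L^r(\mathbb{R}^N)$, $$\mathcal{E}(z,z)\ge c\,\min\left\{\left(\|z\|_s\|z\|_r^{-\theta_1}\right)^{2/(1-\theta_1)},\ \left(\|z\|_s\|z\|_r^{-\theta_2}\right)^{2/(1-\theta_2)}\right\},$$ where $$\theta_1=\frac{r[N(2-s)+\gamma s]}{s[N(2-r)+\gamma r]},\qquad \theta_2=\frac{r(2-s)}{s(2-r)}.$$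
   Context: $N\ge1$ is an integer and $\|\cdot\|_p$ is the norm of $L^p(\mathbb{R}^N)$. The Dirichlet form is $$\mathcal{E}(f,f)=\frac12\int_{\mathbb{R}^N}\int_{\mathbb{R}^N}(f(x)-f(y))^2J(x-y)\,dx\,dy=\int_{\mathbb{R}^N}m(\xi)|\widehat f(\xi)|^2\,d\xi$$ (unitary normalization of the Fourier transform), and $\mathcal{H}_{\mathcal L}(\mathbb{R}^N)=\{f\in L^2(\mathbb{R}^N):\mathcal{E}(f,f)<\infty\}$. *)

theory Defs
  imports "HOL-Analysis.Analysis"
begin

text \<open>Elements of $L^p$ are represented by Lebesgue measurable functions, without passing to
  the quotient by almost everywhere equality. Only real exponents \<^prop>\<open>p > 0\<close> are meant.\<close>

definition Lp_space :: "real \<Rightarrow> ('a::euclidean_space \<Rightarrow> real) set" where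
  "Lp_space p = {f \<in> borel_measurable lebesgue. integrable lebesgue (\<lambda>x. \<bar>f x\<bar> powr p)}"

definition Lp_norm :: "real \<Rightarrow> ('a::euclidean_space \<Rightarrow> real) \<Rightarrow> real" where
  "Lp_norm p f = (LINT x|lebesgue. \<bar>f x\<bar> powr p) powr (1 / p)"

text \<open>A kernel on the punctured space is a function on the whole space whose value at the origin
  is irrelevant: in the definitions below \<open>J 0\<close> is always multiplied by zero.\<close>

definition levy_symbol :: "('a::euclidean_space \<Rightarrow> real) \<Rightarrow> 'a \<Rightarrow> real" where
  "levy_symbol J \<xi> = (LINT z|lebesgue. (1 - cos (z \<bullet> \<xi>)) * J z)"

text \<open>The quadratic form $f \mapsto \mathcal{E}(f,f)$, with values in $[0,\infty]$.\<close>

definition dirichlet_form :: "('a::euclidean_space \<Rightarrow> real) \<Rightarrow> ('a \<Rightarrow> real) \<Rightarrow> ennreal" where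
  "dirichlet_form J f =
     (1/2) * (\<integral>\<^sup>+x. (\<integral>\<^sup>+y. ennreal ((f x - f y)\<^sup>2 * J (x - y)) \<partial>lebesgue) \<partial>lebesgue)"

definition form_domain :: "('a::euclidean_space \<Rightarrow> real) \<Rightarrow> ('a \<Rightarrow> real) set" where
  "form_domain J = {f \<in> Lp_space 2. dirichlet_form J f < \<infinity>}"

end

theory Submission
  imports Defs "HOL-Probability.Characteristic_Functions"
begin

text \<open>Only an integrable part \<open>K \<le> J\<close> of the kernel is used, cut off near the origin; since \<open>\<gamma> \<le> 2\<close>,
  a small cut-off keeps \<open>m(\<xi>) \<ge> c \<bar>\<xi>\<bar>\<^sup>\<gamma>\<close> for \<open>\<bar>\<xi>\<bar> \<le> 1\<close>, and positivity of \<open>m\<close> with the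
  Riemann--Lebesgue lemma gives \<open>m \<ge> c\<close> elsewhere. Let \<open>\<rho>\<^sub>R\<close> be the uniform density on the ball of radius \<open>1 / R\<close>, \<open>R \<le> 1\<close>. Its Fourier transform
  is at least \<open>1 - C R\<^bsup>-\<gamma>\<^esup> m\<close>, so \<open>\<langle>f, f - \<rho>\<^sub>R * f\<rangle> \<le> C R\<^bsup>-\<gamma>\<^esup> \<E>(f,f)\<close>; Plancherel's theorem is replaced here by
  the fact that a convolution form with nonnegative symbol is nonnegative, which follows from
  Gaussian regularisation. Together with \<open>\<langle>f, \<rho>\<^sub>R * f\<rangle> \<le> C R\<^bsup>N(2-r)/r\<^esup> \<parallel>f\<parallel>\<^sub>r\<^sup>2\<close> this bounds
  \<open>\<parallel>f\<parallel>\<^sub>2\<^sup>2\<close>. Choosing \<open>R\<close> such that the second term is at most half of \<open>\<parallel>f\<parallel>\<^sub>2\<^sup>2\<close> gives the claim for \<open>s = 2\<close>,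
  and interpolation between \<open>L\<^sup>r\<close> and \<open>L\<^sup>2\<close> gives it for all \<open>s\<close>.\<close>

section \<open>Translations and the Gaussian density\<close>

text \<open>\<open>J\<close> may fail to be integrable at the origin, so its form cannot be split
  into a multiple of the squared L^2 norm minus a convolution product; for the cut-off kernel both
  pieces are finite, and its form is smaller. For frequencies beyond 1 the symbol is only known to
  exceed a constant, which can absorb a factor \<open>R powr (-\<gamma>)\<close> only if it is at
  least 1, hence R \<le> 1. This restriction is the source of the minimum: an optimal scale below 1
  gives the first term, and R = 1 gives the bound by the squared L^2 norm, which is the second term
  for s = 2. The exponents have a direct meaning: \<open>\<theta>\<^sub>2\<close> solves 1/s =
  \<theta>/r + (1 - \<theta>)/2, the Hoelder exponent between r and 2, and
  \<open>\<theta>\<^sub>1\<close> solves 1/s = \<theta>/r + (1 - \<theta>)(N - \<gamma>)/(2N), the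
  Gagliardo-Nirenberg exponent for the symbol |\<xi>|^\<gamma>. The convolution forms are first
  handled for bounded integrable functions. Members of the form domain need be neither, so they are
  approximated by \<open>soft_clip\<close>, which increases none of the quantities on the
  right.\<close>

lemma lborel_integral_affine:
  fixes f :: "'a::euclidean_space \<Rightarrow> real"
  assumes f [measurable]: "f \<in> borel_measurable borel" and c: "c \<noteq> 0"
  shows "(LINT x|lborel. f x) = \<bar>c\<bar> ^ DIM('a) * (LINT x|lborel. f (t + c *\<^sub>R x))"
proof -
  have "(LINT x|lborel. f x) = (LINT x|density (distr lborel borel (\<lambda>x. t + c *\<^sub>R x)) (\<lambda>_. \<bar>c\<bar>^DIM('a)). f x)"
    using lborel_affine[OF c, of t] by simp
  also have "\<dots> = \<bar>c\<bar> ^ DIM('a) * (LINT x|lborel. f (t + c *\<^sub>R x))"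
    by (subst integral_density) (auto simp: integral_distr)
  finally show ?thesis .
qed

lemma lborel_integrable_affine:
  fixes f :: "'a::euclidean_space \<Rightarrow> real"
  assumes f: "integrable lborel f" and c: "c \<noteq> 0"
  shows "integrable lborel (\<lambda>x. f (t + c *\<^sub>R x))"
proof -
  have [measurable]: "f \<in> borel_measurable borel" using f by auto
  have "integrable (density (distr lborel borel (\<lambda>x. t + c *\<^sub>R x)) (\<lambda>_. \<bar>c\<bar>^DIM('a))) f"
    using lborel_affine[OF c, of t] f by simp
  then have "integrable lborel (\<lambda>x. \<bar>c\<bar> ^ DIM('a) *\<^sub>R f (t + c *\<^sub>R x))"
    by (subst (asm) integrable_density) (auto simp: integrable_distr_eq)
  then show ?thesis using c by simp
qed

lemma lborel_integral_shift:
  fixes f :: "'a::euclidean_space \<Rightarrow> real"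
  assumes "f \<in> borel_measurable borel"
  shows "(LINT x|lborel. f (x - h)) = (LINT x|lborel. f x)"
  using lborel_integral_affine[OF assms, of 1 "-h"] by simp

lemma lborel_integrable_shift:
  fixes f :: "'a::euclidean_space \<Rightarrow> real"
  assumes "integrable lborel f"
  shows "integrable lborel (\<lambda>x. f (x - h))"
  using lborel_integrable_affine[OF assms, of 1 "-h"] by simp

text \<open>Lets \<open>dirichlet_form_ge\<close> use an almost everywhere bound on the kernel at
  \<open>x - y\<close> for fixed \<open>x\<close>: a reflection followed by a translation preserves
  null sets.\<close>

lemma AE_lborel_reflect:
  fixes P :: "'a::euclidean_space \<Rightarrow> bool"
  assumes "AE z in lborel. P z"
  shows "AE y in lborel. P (x - y)"
proof -
  have "AE z in density (distr lborel borel (\<lambda>y. x + (-1) *\<^sub>R y)) (\<lambda>_. ennreal (\<bar>-1\<bar>^DIM('a))). P z"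
    using assms by (subst lborel_affine[of "-1" x, symmetric]) auto
  then have "AE z in distr lborel borel (\<lambda>y. x + (-1) *\<^sub>R y). P z"
    by (subst (asm) AE_density) auto
  then show ?thesis
    by (auto dest!: AE_distrD[rotated])
qed

text \<open>The functions with this property form a closed set in L^1, so it suffices to treat
  indicators of open sets by dominated convergence, pass to Borel sets by outer regularity, and then
  to simple functions and their limits.\<close>

lemma tendsto_translate_L1:
  fixes W :: "'a::euclidean_space \<Rightarrow> real"
  assumes "integrable lborel W" and "h \<longlonglongrightarrow> 0"
  shows "(\<lambda>n. LINT x|lborel. \<bar>W (x - h n) - W x\<bar>) \<longlonglongrightarrow> 0"
proof -
  let ?D = "\<lambda>W n. LINT x|lborel. \<bar>W (x - h n) - W x :: real\<bar>"
  \<comment> \<open>Closedness in L^1. Of the three terms of the estimate, the one comparing the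
    translates of f and g equals the one comparing f and g, by translation invariance.\<close>
  have approx: "?D f \<longlonglongrightarrow> 0"
    if f: "integrable lborel f" and g: "\<And>e. e > 0 \<Longrightarrow> \<exists>g. integrable lborel g \<and> ?D g \<longlonglongrightarrow> 0 \<and> (LINT x|lborel. \<bar>f x - g x\<bar>) \<le> e" for f
  proof (rule LIMSEQ_I)
    fix e :: real assume "e > 0"
    then obtain g where g: "integrable lborel g" "?D g \<longlonglongrightarrow> 0" "(LINT x|lborel. \<bar>f x - g x\<bar>) \<le> e/4"
      using g[of "e/4"] by auto
    obtain N where N: "\<And>n. n \<ge> N \<Longrightarrow> ?D g n < e/4"
      using LIMSEQ_D[OF g(2), of "e/4"] \<open>e > 0\<close> by fastforce
    have "?D f n < e" if "n \<ge> N" for n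
    proof -
      have int: "integrable lborel (\<lambda>x. \<bar>f x - g x\<bar>)" using f g(1) by auto
      have "?D f n \<le> (LINT x|lborel. \<bar>f (x - h n) - g (x - h n)\<bar> + \<bar>g (x - h n) - g x\<bar> + \<bar>f x - g x\<bar>)"
        using f g(1) by (intro integral_mono Bochner_Integration.integrable_add integrable_abs
            Bochner_Integration.integrable_diff lborel_integrable_shift) auto
      also have "\<dots> = (LINT x|lborel. \<bar>f (x - h n) - g (x - h n)\<bar>) + ?D g n + (LINT x|lborel. \<bar>f x - g x\<bar>)"
        using f g(1) by (simp add: lborel_integrable_shift)
      also have "(LINT x|lborel. \<bar>f (x - h n) - g (x - h n)\<bar>) = (LINT x|lborel. \<bar>f x - g x\<bar>)"
        using lborel_integral_shift[of "\<lambda>x. \<bar>f x - g x\<bar>" "h n"] int by auto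
      finally show ?thesis using N[OF that] g(3) \<open>e>0\<close> by linarith
    qed
    moreover have "?D f n \<ge> 0" for n by simp
    ultimately show "\<exists>N. \<forall>n\<ge>N. norm (?D f n - 0) < e" by (intro exI[of _ N]) auto
  qed
  have opn: "?D (indicator U) \<longlonglongrightarrow> 0" if U: "open U" "emeasure lborel U < \<infinity>" for U :: "'a set"
  proof -
    have [measurable]: "U \<in> sets borel" using U by auto
    have i: "integrable lborel (indicator U :: 'a \<Rightarrow> real)" using U by auto
    have im: "integrable lborel (\<lambda>x. indicator U x * indicator U (x - h n) :: real)" for n
      by (rule Bochner_Integration.integrable_bound[OF i]) (auto simp: indicator_def)
    \<comment> \<open>The two halves of the symmetric difference of U and U + h have the same
      measure. The half kept is supported in U, where openness forces pointwise convergence to 0; at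
      boundary points outside U the other half need not converge.\<close>
    have eq: "?D (indicator U) n = 2 * (LINT x|lborel. indicator U x - indicator U x * indicator U (x - h n))" for n
    proof -
      have "?D (indicator U) n = (LINT x|lborel. indicator U (x - h n) + indicator U x - 2 * (indicator U x * indicator U (x - h n)))"
        by (intro Bochner_Integration.integral_cong) (auto simp: indicator_def)
      also have "\<dots> = 2 * (LINT x|lborel. indicator U x - indicator U x * indicator U (x - h n))"
        using i im lborel_integrable_shift[OF i] lborel_integral_shift[of "indicator U" "h n"] by simp
      finally show ?thesis .
    qed
    have "(\<lambda>n. LINT x|lborel. indicator U x - indicator U x * indicator U (x - h n)::real) \<longlonglongrightarrow> integral\<^sup>L (lborel :: 'a measure) (\<lambda>x. 0 :: real)"
    proof (rule integral_dominated_convergence[OF _ _ i])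
      show "AE x in lborel. (\<lambda>n. indicator U x - indicator U x * indicator U (x - h n)::real) \<longlonglongrightarrow> 0"
      proof (rule AE_I2)
        fix x :: 'a
        have "(\<lambda>n. x - h n) \<longlonglongrightarrow> x" using tendsto_diff[OF tendsto_const assms(2), of x] by simp
        then have "x \<in> U \<Longrightarrow> \<forall>\<^sub>F n in sequentially. x - h n \<in> U"
          using U topological_tendstoD by blast
        then have "\<forall>\<^sub>F n in sequentially. indicator U x - indicator U x * indicator U (x - h n) = (0::real)"
          by (cases "x \<in> U") (auto simp: indicator_def elim: eventually_mono)
        then show "(\<lambda>n. indicator U x - indicator U x * indicator U (x - h n)::real) \<longlonglongrightarrow> 0"
          by (rule tendsto_eventually)
      qed
    qed (auto simp: indicator_def)
    then show ?thesis unfolding eq by (simp add: tendsto_mult_right_zero)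
  qed
  show ?thesis using assms(1)
  proof (induction rule: integrable_induct)
    case (base A c)
    have A: "A \<in> sets borel" "emeasure lborel A < \<infinity>" using base by auto
    have "?D (indicator A) \<longlonglongrightarrow> 0"
    proof (rule approx)
      show "integrable lborel (indicator A :: 'a \<Rightarrow> real)" using A by auto
      fix e :: real assume "e > 0"
      obtain U where U: "open U" "A \<subseteq> U" "emeasure lborel (U - A) < ennreal e"
        using outer_regular_lborel[OF A(1), of e] \<open>e > 0\<close> by auto
      have [measurable]: "U \<in> sets borel" "A \<in> sets borel" using U A by auto
      have fin: "emeasure lborel (U - A) < \<infinity>" using U(3) using ennreal_less_top[of e] by (auto intro: less_trans)
      have "emeasure lborel U \<le> emeasure lborel A + emeasure lborel (U - A)"
        using emeasure_subadditive[of A lborel "U - A"] U(2) by (simp add: sup.absorb2)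
      also have "\<dots> < \<infinity>" using fin A(2) by (simp add: ennreal_add_less_top)
      finally have finU: "emeasure lborel U < \<infinity>" .
      have "(LINT x|lborel. \<bar>indicator A x - indicator U x :: real\<bar>) = (LINT x|lborel. indicator (U - A) x)"
        using U(2) by (intro Bochner_Integration.integral_cong) (auto simp: indicator_def)
      also have "\<dots> = measure lborel (U - A)" by simp
      also have "\<dots> \<le> e" using U(3) fin \<open>e>0\<close>
        unfolding measure_def by (intro enn2real_leI) auto
      finally show "\<exists>g. integrable lborel g \<and> ?D g \<longlonglongrightarrow> 0 \<and> (LINT x|lborel. \<bar>indicator A x - g x\<bar>) \<le> e"
        using opn[OF U(1) finU] finU by (intro exI[of _ "indicator U"]) auto
    qed
    then have "(\<lambda>n. ?D (indicator A) n * \<bar>c\<bar>) \<longlonglongrightarrow> 0" by (rule tendsto_mult_left_zero)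
    also have "(\<lambda>n. ?D (indicator A) n * \<bar>c\<bar>) = (\<lambda>n. LINT x|lborel. \<bar>indicator A (x - h n) *\<^sub>R c - indicator A x *\<^sub>R c\<bar>)"
      by (subst Bochner_Integration.integral_mult_left_zero[symmetric]) (simp add: abs_mult[symmetric] left_diff_distrib)
    finally show ?case .
  next
    case (add f g)
    have le: "?D (\<lambda>x. f x + g x) n \<le> ?D f n + ?D g n" for n
      using add.hyps by (subst Bochner_Integration.integral_add[symmetric])
       (auto intro!: integral_mono integrable_abs Bochner_Integration.integrable_add
            Bochner_Integration.integrable_diff lborel_integrable_shift)
    show ?case
      by (rule tendsto_sandwich[OF _ _ tendsto_const tendsto_add_zero[OF add.IH]]) (use le in auto)
  next
    case (lim f s)
    show ?case
    proof (rule approx[OF lim.hyps(4)])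
      fix e :: real assume "e > 0"
      have fm: "f \<in> borel_measurable lborel" "\<And>i. s i \<in> borel_measurable lborel" using lim.hyps(1,4) by auto
      have "(\<lambda>i. LINT x|lborel. \<bar>f x - s i x\<bar>) \<longlonglongrightarrow> integral\<^sup>L (lborel :: 'a measure) (\<lambda>x. 0 :: real)"
      \<comment> \<open>The approximants satisfy |s i x| \<le> 2 |f x|, whence the factor 3.\<close>
      proof (rule integral_dominated_convergence[where w="\<lambda>x. 3 * \<bar>f x\<bar>"])
        show "AE x in lborel. (\<lambda>i. \<bar>f x - s i x\<bar>) \<longlonglongrightarrow> 0"
        proof (rule AE_I2)
          fix x :: 'a
          have "(\<lambda>i. \<bar>f x - s i x\<bar>) \<longlonglongrightarrow> \<bar>f x - f x\<bar>" using lim.hyps(2)[of x] by (intro tendsto_intros) auto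
          then show "(\<lambda>i. \<bar>f x - s i x\<bar>) \<longlonglongrightarrow> 0" by simp
        qed
        show "AE x in lborel. norm \<bar>f x - s i x\<bar> \<le> 3 * \<bar>f x\<bar>" for i
          using lim.hyps(3)[of _ i] by (intro AE_I2) (smt (verit) UNIV_I real_norm_def space_borel space_lborel)
      qed (use lim.hyps(4) fm in auto)
      then obtain i where "(LINT x|lborel. \<bar>f x - s i x\<bar>) < e"
        using LIMSEQ_D[of "\<lambda>i. LINT x|lborel. \<bar>f x - s i x\<bar>" 0 e] \<open>e > 0\<close> by fastforce
      then show "\<exists>g. integrable lborel g \<and> ?D g \<longlonglongrightarrow> 0 \<and> (LINT x|lborel. \<bar>f x - g x\<bar>) \<le> e"
        using lim.hyps(1) lim.IH by (intro exI[of _ "s i"]) auto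
    qed
  qed
qed

section \<open>The Gaussian density and its Fourier transform\<close>

definition gauss_density :: "'a::euclidean_space \<Rightarrow> real" where
  "gauss_density x = (\<Prod>b\<in>Basis. std_normal_density (x \<bullet> b))"

lemma gauss_density_pos: "gauss_density x > 0"
  unfolding gauss_density_def by (intro prod_pos) (simp add: normal_density_pos)

lemma gauss_density_measurable [measurable]: "gauss_density \<in> borel_measurable borel"
  unfolding gauss_density_def by measurable

text \<open>The coordinate map carries the product of one-dimensional Lebesgue measures to
  \<open>lborel\<close>, so Fubini for finite products applies. The values lie in a general field
  because \<open>gauss_density_fourier\<close> has complex factors.\<close>

lemma lborel_product_integral:
  fixes f :: "'a::euclidean_space \<Rightarrow> real \<Rightarrow> 'b::{real_normed_field,banach,second_countable_topology}"
  assumes f: "\<And>b. b \<in> Basis \<Longrightarrow> integrable lborel (f b)"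
  shows "integrable lborel (\<lambda>x. \<Prod>b\<in>Basis. f b (x \<bullet> b))"
    and "(LINT x|lborel. (\<Prod>b\<in>Basis. f b (x \<bullet> b))) = (\<Prod>b\<in>Basis. (LINT t|lborel. f b t))"
proof -
  interpret product_sigma_finite "\<lambda>_. lborel :: real measure" by standard
  have fm: "\<And>b. b \<in> Basis \<Longrightarrow> f b \<in> borel_measurable borel" using f by auto
  have m: "(\<lambda>x. \<Prod>b\<in>Basis. f b (x \<bullet> b)) \<in> borel_measurable borel"
    by (intro borel_measurable_prod measurable_compose[OF _ fm]) auto
  have s: "(\<Prod>b\<in>Basis. f b ((\<Sum>c\<in>Basis. x c *\<^sub>R c) \<bullet> b)) = (\<Prod>b\<in>Basis. f b (x b))" for x :: "'a \<Rightarrow> real"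
    by (intro prod.cong refl) (simp add: inner_sum_left inner_Basis if_distrib sum.delta cong: if_cong)
  have mm: "(\<lambda>x. \<Sum>c\<in>Basis. x c *\<^sub>R c) \<in> (\<Pi>\<^sub>M b\<in>(Basis::'a set). lborel) \<rightarrow>\<^sub>M borel" 
    by measurable
  show "integrable lborel (\<lambda>x. \<Prod>b\<in>Basis. f b (x \<bullet> b))"
    unfolding lborel_eq[where 'a='a] integrable_distr_eq[OF mm m] s
    by (rule product_integrable_prod) (use f in auto)
  show "(LINT x|lborel. (\<Prod>b\<in>Basis. f b (x \<bullet> b))) = (\<Prod>b\<in>Basis. (LINT t|lborel. f b t))"
    unfolding lborel_eq[where 'a='a] integral_distr[OF mm m] s
    by (rule product_integral_prod) (use f in auto)
qed

lemma gauss_density_integrable [simp]: "integrable lborel gauss_density"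
  unfolding gauss_density_def
  by (rule lborel_product_integral) auto

lemma gauss_density_integral [simp]: "(LINT x|lborel. gauss_density x) = 1"
  unfolding gauss_density_def 
  by (subst lborel_product_integral) (auto simp: integral_normal_density)

text \<open>The transform factors into the characteristic functions exp(-t^2 / 2) of the standard
  normal law. Self-reproduction replaces Fourier inversion: it exhibits a Gaussian as a
  superposition of cosines with positive weights.\<close>

lemma gauss_density_fourier:
  "\<exists>C>0. \<forall>\<xi>::'a::euclidean_space. (LINT x|lborel. gauss_density x * cos (x \<bullet> \<xi>)) = C * gauss_density \<xi>"
proof (intro exI conjI allI)
  show "sqrt (2 * pi) ^ DIM('a) > 0" by simp
  fix \<xi> :: 'a
  let ?f = "\<lambda>b t. complex_of_real (std_normal_density t) * iexp ((\<xi> \<bullet> b) * t)"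
  have i: "integrable lborel (?f b)" for b
    by (rule Bochner_Integration.integrable_bound[of _ "std_normal_density"])
       (auto simp: norm_mult intro!: AE_I2)
  have e: "(\<Prod>b\<in>Basis. ?f b (x \<bullet> b)) = of_real (gauss_density x) * iexp (x \<bullet> \<xi>)" for x
    unfolding gauss_density_def of_real_prod prod.distrib exp_sum[OF finite_Basis, symmetric]
      sum_distrib_left[symmetric] of_real_sum[symmetric] 
    by (subst (2) euclidean_inner) (simp add: mult.commute)
  have 1: "(LINT t|lborel. ?f b t) = of_real (exp (- (\<xi> \<bullet> b)\<^sup>2 / 2))" for b
  proof -
    have "(LINT t|lborel. ?f b t) = char std_normal_distribution (\<xi> \<bullet> b)"
      unfolding char_def by (subst integral_density) (auto simp: scaleR_conv_of_real)
    then show ?thesis by (simp add: char_std_normal_distribution)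
  qed
  have "(LINT x|lborel. gauss_density x * cos (x \<bullet> \<xi>)) = (LINT x|lborel. Re (\<Prod>b\<in>Basis. ?f b (x \<bullet> b)))"
    unfolding e by (simp add: Re_exp)
  also have "\<dots> = Re (LINT x|lborel. (\<Prod>b\<in>Basis. ?f b (x \<bullet> b)))"
    by (rule integral_Re[OF lborel_product_integral(1)]) (rule i)
  also have "\<dots> = (\<Prod>b\<in>Basis. exp (- (\<xi> \<bullet> b)\<^sup>2 / 2))"
    by (subst lborel_product_integral(2)[OF i]) (simp only: 1 of_real_prod[symmetric] Re_complex_of_real)
  also have "\<dots> = (\<Prod>b\<in>Basis. sqrt (2 * pi) * std_normal_density (\<xi> \<bullet> b))"
    by (intro prod.cong) (auto simp: std_normal_density_def)
  also have "\<dots> = sqrt (2 * pi) ^ DIM('a) * gauss_density \<xi>"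
    unfolding gauss_density_def prod.distrib by simp
  finally show "(LINT x|lborel. gauss_density x * cos (x \<bullet> \<xi>)) = sqrt (2 * pi) ^ DIM('a) * gauss_density \<xi>" .
qed


section \<open>Convolution forms with nonnegative symbol\<close>

lemma
  fixes f :: "'a::euclidean_space \<Rightarrow> real" and g :: "'b::euclidean_space \<Rightarrow> real"
  assumes f: "integrable lborel f" and g: "integrable lborel g"
  shows integrable_lborel_pair_mult: "integrable (lborel \<Otimes>\<^sub>M lborel) (\<lambda>p. f (fst p) * g (snd p))"
    and integral_lborel_pair_mult: "(LINT p|(lborel \<Otimes>\<^sub>M lborel). f (fst p) * g (snd p)) = (LINT x|lborel. f x) * (LINT x|lborel. g x)"
proof -
  have [measurable]: "f \<in> borel_measurable borel" "g \<in> borel_measurable borel" using f g by auto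
  show i: "integrable (lborel \<Otimes>\<^sub>M lborel) (\<lambda>p. f (fst p) * g (snd p))"
    by (rule lborel_pair.Fubini_integrable) (use f g in \<open>auto simp: abs_mult\<close>)
  show "(LINT p|(lborel \<Otimes>\<^sub>M lborel). f (fst p) * g (snd p)) = (LINT x|lborel. f x) * (LINT x|lborel. g x)"
    by (subst lborel_pair.integral_fst'[OF i, symmetric]) simp
qed

text \<open>\<open>c = 1\<close> gives convolutions, and c equal to the scale gives Gaussian
  averages. Whatever c is, integrating first over the other variable is a pure translation of W, so
  the integral factors.\<close>

lemma
  fixes W g :: "'a::euclidean_space \<Rightarrow> real"
  assumes W: "integrable lborel W" and g: "integrable lborel g"
  shows integrable_lborel_conv: "integrable (lborel \<Otimes>\<^sub>M lborel) (\<lambda>p. W (fst p - c *\<^sub>R snd p) * g (snd p))"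
    and integral_lborel_conv: "(LINT p|(lborel \<Otimes>\<^sub>M lborel). W (fst p - c *\<^sub>R snd p) * g (snd p)) = (LINT x|lborel. W x) * (LINT x|lborel. g x)"
proof -
  have m [measurable]: "W \<in> borel_measurable borel" "g \<in> borel_measurable borel" using W g by auto
  have 1: "integrable (lborel \<Otimes>\<^sub>M lborel) (\<lambda>p. g (fst p) * W (snd p - c *\<^sub>R fst p))"
  proof (rule lborel_pair.Fubini_integrable)
    have "(LINT y|lborel. norm (g x * W (y - c *\<^sub>R x))) = \<bar>g x\<bar> * (LINT y|lborel. \<bar>W y\<bar>)" for x
      using lborel_integral_shift[of "\<lambda>y. \<bar>W y\<bar>" "c *\<^sub>R x"] by (simp add: abs_mult)
    then show "integrable lborel (\<lambda>x. LINT y|lborel. norm (g (fst (x, y)) * W (snd (x, y) - c *\<^sub>R fst (x, y))))"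
      using g by simp
    show "AE x in lborel. integrable lborel (\<lambda>y. g (fst (x, y)) * W (snd (x, y) - c *\<^sub>R fst (x, y)))"
      using lborel_integrable_shift[OF W] by simp
  qed simp
  show "integrable (lborel \<Otimes>\<^sub>M lborel) (\<lambda>p. W (fst p - c *\<^sub>R snd p) * g (snd p))"
    using lborel_pair.integrable_product_swap[OF 1] by (simp add: split_def mult.commute)
  have "(LINT p|(lborel \<Otimes>\<^sub>M lborel). W (fst p - c *\<^sub>R snd p) * g (snd p)) = (LINT p|(lborel \<Otimes>\<^sub>M lborel). g (fst p) * W (snd p - c *\<^sub>R fst p))"
    using lborel_pair.integral_product_swap[of "\<lambda>p. g (fst p) * W (snd p - c *\<^sub>R fst p)"] 1
    by (simp add: split_def mult.commute borel_measurable_integrable)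
  also have "\<dots> = (LINT x|lborel. LINT y|lborel. g x * W (y - c *\<^sub>R x))"
    by (subst lborel_pair.integral_fst'[OF 1, symmetric]) simp
  also have "\<dots> = (LINT x|lborel. W x) * (LINT x|lborel. g x)"
    by (simp add: lborel_integral_shift)
  finally show "(LINT p|(lborel \<Otimes>\<^sub>M lborel). W (fst p - c *\<^sub>R snd p) * g (snd p)) = (LINT x|lborel. W x) * (LINT x|lborel. g x)" .
qed

text \<open>The weight now sits at the first point. Exchanging the points replaces g by its
  reflection, which has the same integral, and reduces to the previous case with
  \<open>c = 1\<close>.\<close>

lemma
  fixes g h :: "'a::euclidean_space \<Rightarrow> real"
  assumes g: "integrable lborel g" and h: "integrable lborel h"
  shows integrable_lborel_conv_fst: "integrable (lborel \<Otimes>\<^sub>M lborel) (\<lambda>p. g (fst p - snd p) * h (fst p))"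
    and integral_lborel_conv_fst: "(LINT p|(lborel \<Otimes>\<^sub>M lborel). g (fst p - snd p) * h (fst p)) = (LINT x|lborel. g x) * (LINT x|lborel. h x)"
proof -
  have g': "integrable lborel (\<lambda>x. g (- x))" using lborel_integrable_affine[OF g, of "-1" 0] by simp
  have gm: "g \<in> borel_measurable borel" using g by auto
  have G': "(LINT x|lborel. g (- x)) = (LINT x|lborel. g x)"
    using lborel_integral_affine[OF gm, of "-1" 0] by simp
  have j: "integrable (lborel \<Otimes>\<^sub>M lborel) (\<lambda>p. g (snd p - fst p) * h (snd p))"
    using integrable_lborel_conv[OF g' h, of 1] by simp
  have ej: "(LINT p|(lborel \<Otimes>\<^sub>M lborel). g (snd p - fst p) * h (snd p)) = (LINT x|lborel. g x) * (LINT x|lborel. h x)"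
    using integral_lborel_conv[OF g' h, of 1] G' by simp
  show "integrable (lborel \<Otimes>\<^sub>M lborel) (\<lambda>p. g (fst p - snd p) * h (fst p))"
    using lborel_pair.integrable_product_swap[OF j] by (simp add: split_def)
  show "(LINT p|(lborel \<Otimes>\<^sub>M lborel). g (fst p - snd p) * h (fst p)) = (LINT x|lborel. g x) * (LINT x|lborel. h x)"
    using lborel_pair.integral_product_swap[of "\<lambda>p. g (snd p - fst p) * h (snd p)"] j ej
    by (simp add: split_def borel_measurable_integrable)
qed

text \<open>The bound on f dominates the integrand by M |W(x - y)| |f(y)|, a convolution
  integrand.\<close>

lemma integrable_lborel_form:
  fixes W f :: "'a::euclidean_space \<Rightarrow> real"
  assumes W: "integrable lborel W" and f: "integrable lborel f" and M: "\<And>x. \<bar>f x\<bar> \<le> M"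
  shows "integrable (lborel \<Otimes>\<^sub>M lborel) (\<lambda>p. W (fst p - snd p) * (f (fst p) * f (snd p)))"
proof (rule Bochner_Integration.integrable_bound)
  have [measurable]: "W \<in> borel_measurable borel" "f \<in> borel_measurable borel" using W f by auto
  show "integrable (lborel \<Otimes>\<^sub>M lborel) (\<lambda>p. M * (W (fst p - snd p) * f (snd p)))"
    using integrable_lborel_conv[OF W f, of 1] by simp
  show "(\<lambda>p. W (fst p - snd p) * (f (fst p) * f (snd p))) \<in> borel_measurable (lborel \<Otimes>\<^sub>M lborel)"
    by simp
  show "AE p in lborel \<Otimes>\<^sub>M lborel. norm (W (fst p - snd p) * (f (fst p) * f (snd p))) \<le> norm (M * (W (fst p - snd p) * f (snd p)))"
  proof (rule AE_I2)
    fix p :: "'a \<times> 'a"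
    have "\<bar>f (fst p)\<bar> \<le> \<bar>M\<bar>" using M[of "fst p"] by linarith
    then have "\<bar>f (fst p)\<bar> * (\<bar>W (fst p - snd p)\<bar> * \<bar>f (snd p)\<bar>) \<le> \<bar>M\<bar> * (\<bar>W (fst p - snd p)\<bar> * \<bar>f (snd p)\<bar>)"
      by (intro mult_right_mono) auto
    then show "norm (W (fst p - snd p) * (f (fst p) * f (snd p))) \<le> norm (M * (W (fst p - snd p) * f (snd p)))"
      by (simp add: abs_mult mult_ac)
  qed
qed

text \<open>The easy half of Bochner's theorem. After Fubini and the addition formulas, the cosine
  part contributes A times the squared modulus of the Fourier transform of f, and the sine part
  cancels because it is antisymmetric in the two points. The sine part is present because the
  kernels to be represented need not be even.\<close>

lemma form_positive_definite:
  fixes A B g f :: "'a::euclidean_space \<Rightarrow> real"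
  assumes [measurable]: "A \<in> borel_measurable borel" "B \<in> borel_measurable borel"
    and A: "\<And>\<xi>. 0 \<le> A \<xi>" "\<And>\<xi>. A \<xi> \<le> b" and B: "\<And>\<xi>. \<bar>B \<xi>\<bar> \<le> b"
    and g: "integrable lborel g" "\<And>\<xi>. 0 \<le> g \<xi>" and f: "integrable lborel f"
  shows "0 \<le> (LINT p|(lborel \<Otimes>\<^sub>M lborel). (LINT \<xi>|lborel. g \<xi> * (A \<xi> * cos (e *\<^sub>R (fst p - snd p) \<bullet> \<xi>)
           + B \<xi> * sin (e *\<^sub>R (fst p - snd p) \<bullet> \<xi>))) * (f (fst p) * f (snd p)))"
proof -
  have [measurable]: "g \<in> borel_measurable borel" "f \<in> borel_measurable borel" using g f by auto
  let ?h = "\<lambda>p \<xi>. g \<xi> * (A \<xi> * cos (e *\<^sub>R (fst p - snd p) \<bullet> \<xi>) + B \<xi> * sin (e *\<^sub>R (fst p - snd p) \<bullet> \<xi>)) * (f (fst p) * f (snd p))"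
  have "b \<ge> 0" using A[of 0] by linarith
  have int: "integrable (lborel \<Otimes>\<^sub>M lborel) (\<lambda>q::('a\<times>'a)\<times>'a. ?h (fst q) (snd q))"
  proof (rule Bochner_Integration.integrable_bound)
    show "integrable (lborel \<Otimes>\<^sub>M lborel) (\<lambda>q::('a\<times>'a)\<times>'a. (f (fst (fst q)) * f (snd (fst q))) * (2 * b * g (snd q)))"
      by (rule integrable_lborel_pair_mult) (use integrable_lborel_pair_mult[OF f f] g in \<open>auto simp: lborel_prod\<close>)
    show "(\<lambda>q::('a\<times>'a)\<times>'a. ?h (fst q) (snd q)) \<in> borel_measurable (lborel \<Otimes>\<^sub>M lborel)"
      unfolding lborel_prod[symmetric] by measurable
    show "AE q in lborel \<Otimes>\<^sub>M lborel. norm (?h (fst q) (snd q)) \<le> norm ((f (fst (fst q)) * f (snd (fst q))) * (2 * b * g (snd q)))"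
    proof (rule AE_I2)
      fix q :: "('a\<times>'a)\<times>'a"
      obtain x y \<xi> where q: "q = ((x,y),\<xi>)" by (metis surj_pair)
      have "\<bar>A \<xi> * cos (e *\<^sub>R (x - y) \<bullet> \<xi>)\<bar> \<le> b * 1" unfolding abs_mult using A[of \<xi>] by (intro mult_mono) auto
      moreover have "\<bar>B \<xi> * sin (e *\<^sub>R (x - y) \<bullet> \<xi>)\<bar> \<le> b * 1" unfolding abs_mult using B[of \<xi>] \<open>b \<ge> 0\<close> by (intro mult_mono) auto
      ultimately have "\<bar>A \<xi> * cos (e *\<^sub>R (x - y) \<bullet> \<xi>) + B \<xi> * sin (e *\<^sub>R (x - y) \<bullet> \<xi>)\<bar> \<le> 2 * b" by linarith
      then have "\<bar>A \<xi> * cos (e *\<^sub>R (x - y) \<bullet> \<xi>) + B \<xi> * sin (e *\<^sub>R (x - y) \<bullet> \<xi>)\<bar> * (\<bar>g \<xi>\<bar> * (\<bar>f x\<bar> * \<bar>f y\<bar>)) \<le> 2 * b * (\<bar>g \<xi>\<bar> * (\<bar>f x\<bar> * \<bar>f y\<bar>))"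
        by (intro mult_right_mono) auto
      then show "norm (?h (fst q) (snd q)) \<le> norm ((f (fst (fst q)) * f (snd (fst q))) * (2 * b * g (snd q)))"
        using \<open>b \<ge> 0\<close> unfolding q by (simp add: abs_mult mult_ac)
    qed
  qed
  let ?c = "\<lambda>\<xi> x. cos (e *\<^sub>R x \<bullet> \<xi>) * f x" and ?s = "\<lambda>\<xi> x. sin (e *\<^sub>R x \<bullet> \<xi>) * f x"
  have ci: "integrable lborel (?c \<xi>)" and si: "integrable lborel (?s \<xi>)" for \<xi>
    by (auto intro!: Bochner_Integration.integrable_bound[OF f] AE_I2 mult_left_le_one_le simp: abs_mult)
  let ?F = "\<lambda>u v p. u (fst p) * v (snd p)"
  have inner: "(LINT p|lborel. ?h p \<xi>) = g \<xi> * (A \<xi> * ((LINT x|lborel. ?c \<xi> x)\<^sup>2 + (LINT x|lborel. ?s \<xi> x)\<^sup>2))" for \<xi>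
  proof -
    have 1: "?h p \<xi> = g \<xi> * A \<xi> * (?F (?c \<xi>) (?c \<xi>) p + ?F (?s \<xi>) (?s \<xi>) p) + g \<xi> * B \<xi> * (?F (?s \<xi>) (?c \<xi>) p - ?F (?c \<xi>) (?s \<xi>) p)" for p
      by (simp add: scaleR_diff_right inner_diff_left cos_diff sin_diff algebra_simps)
    have 2: "(LINT p|lborel. a * (?F u u p + ?F v v p) + c * (?F v u p - ?F u v p)) = a * ((LINT x|lborel. u x)\<^sup>2 + (LINT x|lborel. v x)\<^sup>2)"
      if "integrable lborel u" "integrable lborel v" for a c and u v :: "'a \<Rightarrow> real"
      using that unfolding lborel_prod[symmetric]
      by (simp add: integrable_lborel_pair_mult integral_lborel_pair_mult power2_eq_square)
    show ?thesis unfolding 1 2[OF ci si] by (simp add: mult.assoc)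
  qed
  have "(LINT p|(lborel \<Otimes>\<^sub>M lborel). (LINT \<xi>|lborel. g \<xi> * (A \<xi> * cos (e *\<^sub>R (fst p - snd p) \<bullet> \<xi>)
           + B \<xi> * sin (e *\<^sub>R (fst p - snd p) \<bullet> \<xi>))) * (f (fst p) * f (snd p))) = (LINT p|lborel. LINT \<xi>|lborel. ?h p \<xi>)"
    unfolding lborel_prod by simp
  also have "\<dots> = (LINT \<xi>|lborel. LINT p|lborel. ?h p \<xi>)"
    by (rule lborel_pair.Fubini_integral[symmetric]) (use int in \<open>simp add: split_def\<close>)
  also have "\<dots> \<ge> 0" unfolding inner using g A by (intro integral_nonneg_AE AE_I2) simp
  finally show ?thesis .
qed


section \<open>Gaussian regularisation of the kernel and its removal\<close>

lemma integrable_gauss_average: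
  fixes W :: "'a::euclidean_space \<Rightarrow> real"
  assumes W: "integrable lborel W"
  shows "integrable lborel (\<lambda>t. LINT z|lborel. W (t - e *\<^sub>R z) * gauss_density z)"
  using lborel_pair.integrable_fst'[OF integrable_lborel_conv[OF W gauss_density_integrable, of e]] by simp

text \<open>By Fubini the distance is at most the Gaussian average over z of the L^1 distances
  between W and its translate by \<open>e n *\<^sub>R z\<close>. These tend to 0 for each z and are
  at most twice the L^1 norm of W, so dominated convergence applies.\<close>

lemma gauss_average_tendsto_L1:
  fixes W :: "'a::euclidean_space \<Rightarrow> real"
  assumes W: "integrable lborel W" and e: "e \<longlonglongrightarrow> 0"
  shows "(\<lambda>n. LINT t|lborel. \<bar>(LINT z|lborel. W (t - e n *\<^sub>R z) * gauss_density z) - W t\<bar>) \<longlonglongrightarrow> 0"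
proof (rule tendsto_sandwich[OF _ _ tendsto_const])
  have [measurable]: "W \<in> borel_measurable borel" using W by auto
  let ?D = "\<lambda>h. LINT t|lborel. \<bar>W (t - h) - W t\<bar>"
  have int: "integrable (lborel \<Otimes>\<^sub>M lborel) (\<lambda>p. W (fst p - e n *\<^sub>R snd p) * gauss_density (snd p) - W (fst p) * gauss_density (snd p))" for n
    by (intro Bochner_Integration.integrable_diff integrable_lborel_conv[OF W] integrable_lborel_pair_mult[OF W]) auto
  have "(\<lambda>n. LINT z|lborel. gauss_density z * ?D (e n *\<^sub>R z)) \<longlonglongrightarrow> integral\<^sup>L lborel (\<lambda>z::'a. 0 :: real)"
  proof (rule integral_dominated_convergence[where w="\<lambda>z. (2 * (LINT t|lborel. \<bar>W t\<bar>)) * gauss_density z"])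
    show "AE z in lborel. (\<lambda>n. gauss_density z * ?D (e n *\<^sub>R z)) \<longlonglongrightarrow> 0"
    proof (intro AE_I2 tendsto_mult_right_zero tendsto_translate_L1[OF W])
      show "(\<lambda>n. e n *\<^sub>R z) \<longlonglongrightarrow> 0" for z :: 'a using tendsto_scaleR[OF e tendsto_const, of z] by simp
    qed
    show "AE z in lborel. norm (gauss_density z * ?D (e n *\<^sub>R z)) \<le> (2 * (LINT t|lborel. \<bar>W t\<bar>)) * gauss_density z" for n
    proof (rule AE_I2)
      fix z :: 'a
      have "?D (e n *\<^sub>R z) \<le> (LINT t|lborel. \<bar>W (t - e n *\<^sub>R z)\<bar> + \<bar>W t\<bar>)"
        using W lborel_integrable_shift[OF W] by (intro integral_mono) auto
      also have "\<dots> = 2 * (LINT t|lborel. \<bar>W t\<bar>)"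
        using W lborel_integrable_shift[OF W] lborel_integral_shift[of "\<lambda>t. \<bar>W t\<bar>" "e n *\<^sub>R z"] by simp
      finally show "norm (gauss_density z * ?D (e n *\<^sub>R z)) \<le> (2 * (LINT t|lborel. \<bar>W t\<bar>)) * gauss_density z"
        using gauss_density_pos[of z] by (simp add: abs_mult mult.commute mult_left_mono)
    qed
  qed auto
  then show "(\<lambda>n. LINT z|lborel. gauss_density z * ?D (e n *\<^sub>R z)) \<longlonglongrightarrow> 0" by simp
  show "\<forall>\<^sub>F n in sequentially. (LINT t|lborel. \<bar>(LINT z|lborel. W (t - e n *\<^sub>R z) * gauss_density z) - W t\<bar>) \<le> (LINT z|lborel. gauss_density z * ?D (e n *\<^sub>R z))"
  proof (intro always_eventually allI)
    fix n
    let ?d = "\<lambda>t z. W (t - e n *\<^sub>R z) * gauss_density z - W t * gauss_density z"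
    \<comment> \<open>The integrand in z is integrable for almost every t only; elsewhere the
      integral has its default value 0, and \<open>W t\<close> cannot be pulled inside.\<close>
    have 1: "AE t in lborel. (LINT z|lborel. W (t - e n *\<^sub>R z) * gauss_density z) - W t = (LINT z|lborel. ?d t z)"
      using lborel_pair.AE_integrable_fst'[OF integrable_lborel_conv[OF W gauss_density_integrable, of "e n"]]
      by eventually_elim simp
    have "(LINT t|lborel. \<bar>(LINT z|lborel. W (t - e n *\<^sub>R z) * gauss_density z) - W t\<bar>) = (LINT t|lborel. \<bar>LINT z|lborel. ?d t z\<bar>)"
      by (rule integral_cong_AE) (use 1 in auto)
    also have "\<dots> \<le> (LINT t|lborel. LINT z|lborel. \<bar>?d t z\<bar>)"
      using lborel_pair.integrable_fst'[OF int[of n]] lborel_pair.integrable_fst'[OF integrable_abs[OF int[of n]]]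
      by (intro integral_mono) auto
    also have "\<dots> = (LINT z|lborel. LINT t|lborel. \<bar>?d t z\<bar>)"
      using lborel_pair.Fubini_integral[of "\<lambda>t z. \<bar>?d t z\<bar>"] integrable_abs[OF int[of n]] by (simp add: split_def)
    also have "\<dots> = (LINT z|lborel. gauss_density z * ?D (e n *\<^sub>R z))"
    proof (intro Bochner_Integration.integral_cong refl)
      fix z :: 'a
      have "\<bar>?d t z\<bar> = gauss_density z * \<bar>W (t - e n *\<^sub>R z) - W t\<bar>" for t
        using gauss_density_pos[of z] by (subst left_diff_distrib[symmetric]) (simp add: abs_mult)
      then show "(LINT t|lborel. \<bar>?d t z\<bar>) = gauss_density z * ?D (e n *\<^sub>R z)" by simp
    qed
    finally show "(LINT t|lborel. \<bar>(LINT z|lborel. W (t - e n *\<^sub>R z) * gauss_density z) - W t\<bar>) \<le> (LINT z|lborel. gauss_density z * ?D (e n *\<^sub>R z))" .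
  qed
qed auto

text \<open>By the arithmetic-geometric mean inequality f(x) f(y) is at most the mean of the two
  squares, and each square integrates to the mass of g times the squared L^2 norm of f.\<close>

lemma convolution_form_le:
  fixes f :: "'a::euclidean_space \<Rightarrow> real"
  assumes f: "integrable lborel f" and M: "\<And>x. \<bar>f x\<bar> \<le> M" and g: "integrable lborel g" "\<And>x. 0 \<le> g x"
  shows "(LINT p|(lborel \<Otimes>\<^sub>M lborel). g (fst p - snd p) * (f (fst p) * f (snd p)))
    \<le> (LINT x|lborel. g x) * (LINT x|lborel. (f x)\<^sup>2)"
    and "integrable lborel (\<lambda>x. (f x)\<^sup>2)"
proof -
  have [measurable]: "f \<in> borel_measurable borel" using f by auto
  have M0: "M \<ge> 0" using M[of 0] by linarith
  show f2: "integrable lborel (\<lambda>x. (f x)\<^sup>2)"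
  proof (rule Bochner_Integration.integrable_bound)
    show "integrable lborel (\<lambda>x. M * f x)" using f by simp
    show "AE x in lborel. norm ((f x)\<^sup>2) \<le> norm (M * f x)"
    proof (rule AE_I2)
      fix x
      have "\<bar>f x\<bar> * \<bar>f x\<bar> \<le> M * \<bar>f x\<bar>" using M by (intro mult_right_mono) auto
      then show "norm ((f x)\<^sup>2) \<le> norm (M * f x)" using M0 by (simp add: power2_eq_square abs_mult)
    qed
  qed simp
  have i1: "integrable (lborel \<Otimes>\<^sub>M lborel) (\<lambda>p. g (fst p - snd p) * (f (snd p))\<^sup>2)"
    and e1: "(LINT p|(lborel \<Otimes>\<^sub>M lborel). g (fst p - snd p) * (f (snd p))\<^sup>2) = (LINT x|lborel. g x) * (LINT x|lborel. (f x)\<^sup>2)"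
    using integrable_lborel_conv[OF g(1) f2, of 1] integral_lborel_conv[OF g(1) f2, of 1] by simp_all
  note i2 = integrable_lborel_conv_fst[OF g(1) f2] and e2 = integral_lborel_conv_fst[OF g(1) f2]
  have "(LINT p|(lborel \<Otimes>\<^sub>M lborel). g (fst p - snd p) * (f (fst p) * f (snd p)))
    \<le> (LINT p|(lborel \<Otimes>\<^sub>M lborel). (g (fst p - snd p) * (f (fst p))\<^sup>2 + g (fst p - snd p) * (f (snd p))\<^sup>2) / 2)"
  proof (rule integral_mono[OF integrable_lborel_form[OF g(1) f M]])
    show "integrable (lborel \<Otimes>\<^sub>M lborel) (\<lambda>p. (g (fst p - snd p) * (f (fst p))\<^sup>2 + g (fst p - snd p) * (f (snd p))\<^sup>2) / 2)"
      using i1 i2 by simp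
    fix p :: "'a \<times> 'a"
    have "f (fst p) * f (snd p) \<le> ((f (fst p))\<^sup>2 + (f (snd p))\<^sup>2) / 2"
      using sum_squares_bound[of "f (fst p)" "f (snd p)"] by simp
    then have "g (fst p - snd p) * (f (fst p) * f (snd p)) \<le> g (fst p - snd p) * (((f (fst p))\<^sup>2 + (f (snd p))\<^sup>2) / 2)"
      using g(2) by (rule mult_left_mono)
    then show "g (fst p - snd p) * (f (fst p) * f (snd p)) \<le> (g (fst p - snd p) * (f (fst p))\<^sup>2 + g (fst p - snd p) * (f (snd p))\<^sup>2) / 2"
      by (simp add: distrib_left)
  qed
  also have "\<dots> = (LINT x|lborel. g x) * (LINT x|lborel. (f x)\<^sup>2)"
    using i1 i2 e1 e2 by simp
  finally show "(LINT p|(lborel \<Otimes>\<^sub>M lborel). g (fst p - snd p) * (f (fst p) * f (snd p)))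
    \<le> (LINT x|lborel. g x) * (LINT x|lborel. (f x)\<^sup>2)" .
qed


text \<open>\<open>\<kappa>\<close> is the weight of a point mass at the origin, so the hypothesis
  says that the measure \<open>\<kappa>\<close> \<delta> + W has a nonnegative real part of its
  Fourier transform. Convolving with a Gaussian of width e turns this measure into a function that
  \<open>form_positive_definite\<close> covers.\<close>

lemma gauss_average_form_nonneg:
  fixes W f :: "'a::euclidean_space \<Rightarrow> real"
  assumes W: "integrable lborel W" and k: "0 \<le> \<kappa>"
    and sym: "\<And>\<xi>. 0 \<le> \<kappa> + (LINT u|lborel. W u * cos (u \<bullet> \<xi>))"
    and f: "integrable lborel f" and M: "\<And>x. \<bar>f x\<bar> \<le> M" and e: "e > 0"
  shows "0 \<le> \<kappa> * (LINT x|lborel. (f x)\<^sup>2) + (LINT p|(lborel \<Otimes>\<^sub>M lborel).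
     (LINT z|lborel. W (fst p - snd p - e *\<^sub>R z) * gauss_density z) * (f (fst p) * f (snd p)))"
proof -
  have [measurable]: "W \<in> borel_measurable borel" using W by auto
  obtain C where C: "C > 0" "\<And>\<xi>::'a. (LINT x|lborel. gauss_density x * cos (x \<bullet> \<xi>)) = C * gauss_density \<xi>"
    using gauss_density_fourier by blast
  let ?e = "e ^ DIM('a)" and ?V = "\<lambda>t. LINT z|lborel. W (t - e *\<^sub>R z) * gauss_density z"
  let ?g = "\<lambda>t. gauss_density ((1/e) *\<^sub>R t :: 'a)"
  define A where "A \<xi> = \<kappa> + (LINT u|lborel. W u * cos ((1/e) *\<^sub>R u \<bullet> \<xi>))" for \<xi>
  define B where "B \<xi> = (LINT u|lborel. W u * sin ((1/e) *\<^sub>R u \<bullet> \<xi>))" for \<xi>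
  have Wb: "integrable lborel (\<lambda>u. W u * s u)" "\<bar>LINT u|lborel. W u * s u\<bar> \<le> (LINT u|lborel. \<bar>W u\<bar>)"
    if [measurable]: "s \<in> borel_measurable borel" and s: "\<And>u. \<bar>s u\<bar> \<le> 1" for s
  proof -
    have le: "\<bar>W u * s u\<bar> \<le> \<bar>W u\<bar>" for u
      unfolding abs_mult using mult_left_mono[OF s, of "\<bar>W u\<bar>" u] by simp
    show i: "integrable lborel (\<lambda>u. W u * s u)"
      by (rule Bochner_Integration.integrable_bound[OF W]) (use le in auto)
    have "\<bar>LINT u|lborel. W u * s u\<bar> \<le> (LINT u|lborel. \<bar>W u * s u\<bar>)" by (rule integral_abs_bound)
    also have "\<dots> \<le> (LINT u|lborel. \<bar>W u\<bar>)" using i W le by (intro integral_mono) auto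
    finally show "\<bar>LINT u|lborel. W u * s u\<bar> \<le> (LINT u|lborel. \<bar>W u\<bar>)" .
  qed
  have [measurable]: "A \<in> borel_measurable borel" "B \<in> borel_measurable borel"
    unfolding A_def B_def by measurable
  have Ab: "\<bar>A \<xi> - \<kappa>\<bar> \<le> (LINT u|lborel. \<bar>W u\<bar>)" for \<xi>
    unfolding A_def add_diff_cancel_left' by (rule Wb(2)) auto
  have Bb: "\<bar>B \<xi>\<bar> \<le> (LINT u|lborel. \<bar>W u\<bar>)" for \<xi>
    unfolding B_def by (rule Wb(2)) auto
  \<comment> \<open>Substituting u = t - e z turns the average into the convolution of W with
    \<open>?g\<close>, and \<open>gauss_density_fourier\<close> expands the Gaussian in cosines.
    \<open>A\<close> and \<open>B\<close> are the cosine and sine transforms, at frequency \<xi> /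
    e, of the measure \<open>\<kappa>\<close> \<delta> + W.\<close>
  have key: "\<kappa> * ?g t + ?e * ?V t = (LINT \<xi>|lborel. (gauss_density \<xi> / C) * (A \<xi> * cos ((1/e) *\<^sub>R t \<bullet> \<xi>) + B \<xi> * sin ((1/e) *\<^sub>R t \<bullet> \<xi>)))" for t
  proof -
    have gc: "integrable lborel (\<lambda>\<xi>. gauss_density \<xi> * s \<xi>)" 
      if [measurable]: "s \<in> borel_measurable borel" and s: "\<And>u. \<bar>s u\<bar> \<le> K" for s K
    proof (rule Bochner_Integration.integrable_bound[of _ "\<lambda>\<xi>. K * gauss_density \<xi>"])
      show "AE x in lborel. norm (gauss_density x * s x) \<le> norm (K * gauss_density x)"
      proof (rule AE_I2)
        fix x
        have "\<bar>s x\<bar> * gauss_density x \<le> \<bar>K\<bar> * gauss_density x"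
          using s[of x] gauss_density_pos[of x] by (intro mult_right_mono) auto
        then show "norm (gauss_density x * s x) \<le> norm (K * gauss_density x)"
          using gauss_density_pos[of x] by (simp add: abs_mult mult.commute)
      qed
    qed auto
    have int: "integrable (lborel \<Otimes>\<^sub>M lborel) (\<lambda>p. W (fst p) * gauss_density (snd p) * cos ((1/e) *\<^sub>R (t - fst p) \<bullet> snd p))"
    proof (rule Bochner_Integration.integrable_bound[OF integrable_lborel_pair_mult[OF W gauss_density_integrable]])
      show "AE p in lborel \<Otimes>\<^sub>M lborel. norm (W (fst p) * gauss_density (snd p) * cos ((1/e) *\<^sub>R (t - fst p) \<bullet> snd p)) \<le> norm (W (fst p) * gauss_density (snd p))"
        by (intro AE_I2) (simp add: abs_mult mult_left_le)
    qed measurable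
    have "?e * ?V t = (LINT u|lborel. W u * ?g (t - u))"
    proof -
      have m: "(\<lambda>u. W u * ?g (t - u)) \<in> borel_measurable borel" by measurable
      show ?thesis using lborel_integral_affine[OF m, of "-e" t] e by simp
    qed
    also have "\<dots> = (LINT u|lborel. W u * ((LINT \<xi>|lborel. gauss_density \<xi> * cos (\<xi> \<bullet> (1/e) *\<^sub>R (t - u))) / C))"
      by (simp only: C(2)) (use C(1) in simp)
    also have "\<dots> = (LINT u|lborel. (LINT \<xi>|lborel. W u * gauss_density \<xi> * cos ((1/e) *\<^sub>R (t - u) \<bullet> \<xi>))) / C"
    proof -
      have "(LINT \<xi>|lborel. W u * gauss_density \<xi> * cos ((1/e) *\<^sub>R (t - u) \<bullet> \<xi>)) = W u * (LINT \<xi>|lborel. gauss_density \<xi> * cos (\<xi> \<bullet> (1/e) *\<^sub>R (t - u)))" for u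
        by (simp only: integral_mult_right_zero[symmetric] inner_commute[of _ "(1/e) *\<^sub>R (t - u)"] mult.assoc)
      then show ?thesis by (simp only: times_divide_eq_right integral_divide_zero)
    qed
    also have "\<dots> = (LINT \<xi>|lborel. (LINT u|lborel. W u * gauss_density \<xi> * cos ((1/e) *\<^sub>R (t - u) \<bullet> \<xi>))) / C"
      by (rule arg_cong[where f="\<lambda>x. x / C"], rule lborel_pair.Fubini_integral[symmetric]) (use int in \<open>simp add: split_def\<close>)
    also have "\<dots> = (LINT \<xi>|lborel. gauss_density \<xi> * ((A \<xi> - \<kappa>) * cos ((1/e) *\<^sub>R t \<bullet> \<xi>) + B \<xi> * sin ((1/e) *\<^sub>R t \<bullet> \<xi>))) / C"
    proof (rule arg_cong[where f="\<lambda>x. x / C"], rule Bochner_Integration.integral_cong[OF refl])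
      fix \<xi> :: 'a
      define c where "c u = cos ((1/e) *\<^sub>R u \<bullet> \<xi>)" for u
      define s where "s u = sin ((1/e) *\<^sub>R u \<bullet> \<xi>)" for u
      have ci: "integrable lborel (\<lambda>u. W u * c u)" "integrable lborel (\<lambda>u. W u * s u)"
        unfolding c_def s_def by (auto intro!: Wb)
      have "W u * gauss_density \<xi> * cos ((1/e) *\<^sub>R (t - u) \<bullet> \<xi>) = gauss_density \<xi> * c t * (W u * c u) + gauss_density \<xi> * s t * (W u * s u)" for u
        unfolding c_def s_def by (simp add: scaleR_diff_right inner_diff_left cos_diff algebra_simps)
      then have "(LINT u|lborel. W u * gauss_density \<xi> * cos ((1/e) *\<^sub>R (t - u) \<bullet> \<xi>)) = gauss_density \<xi> * c t * (LINT u|lborel. W u * c u) + gauss_density \<xi> * s t * (LINT u|lborel. W u * s u)"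
        using ci by simp
      then show "(LINT u|lborel. W u * gauss_density \<xi> * cos ((1/e) *\<^sub>R (t - u) \<bullet> \<xi>)) = gauss_density \<xi> * ((A \<xi> - \<kappa>) * cos ((1/e) *\<^sub>R t \<bullet> \<xi>) + B \<xi> * sin ((1/e) *\<^sub>R t \<bullet> \<xi>))"
        unfolding A_def B_def c_def s_def by (simp add: algebra_simps)
    qed
    finally have 1: "?e * ?V t = (LINT \<xi>|lborel. gauss_density \<xi> * ((A \<xi> - \<kappa>) * cos ((1/e) *\<^sub>R t \<bullet> \<xi>) + B \<xi> * sin ((1/e) *\<^sub>R t \<bullet> \<xi>))) / C" .
    have 2: "\<kappa> * ?g t = (LINT \<xi>|lborel. \<kappa> * (gauss_density \<xi> * cos ((1/e) *\<^sub>R t \<bullet> \<xi>))) / C"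
      by (simp only: integral_mult_right_zero inner_commute[of "(1/e) *\<^sub>R t"] C(2)) (use C(1) in simp)
    have "integrable lborel (\<lambda>\<xi>. gauss_density \<xi> * ((A \<xi> - \<kappa>) * cos ((1/e) *\<^sub>R t \<bullet> \<xi>) + B \<xi> * sin ((1/e) *\<^sub>R t \<bullet> \<xi>)))"
    proof (rule gc)
      fix \<xi>
      have "\<bar>(A \<xi> - \<kappa>) * cos ((1/e) *\<^sub>R t \<bullet> \<xi>)\<bar> \<le> (LINT u|lborel. \<bar>W u\<bar>) * 1"
        unfolding abs_mult by (intro mult_mono Ab abs_cos_le_one) simp_all
      moreover have "\<bar>B \<xi> * sin ((1/e) *\<^sub>R t \<bullet> \<xi>)\<bar> \<le> (LINT u|lborel. \<bar>W u\<bar>) * 1"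
        unfolding abs_mult by (intro mult_mono Bb abs_sin_le_one) simp_all
      ultimately show "\<bar>(A \<xi> - \<kappa>) * cos ((1/e) *\<^sub>R t \<bullet> \<xi>) + B \<xi> * sin ((1/e) *\<^sub>R t \<bullet> \<xi>)\<bar> \<le> 2 * (LINT u|lborel. \<bar>W u\<bar>)"
        by linarith
    qed measurable
    moreover have "integrable lborel (\<lambda>\<xi>. \<kappa> * (gauss_density \<xi> * cos ((1/e) *\<^sub>R t \<bullet> \<xi>)))"
      by (intro integrable_mult_right gc[of _ 1]) auto
    ultimately have "\<kappa> * ?g t + ?e * ?V t = (LINT \<xi>|lborel. \<kappa> * (gauss_density \<xi> * cos ((1/e) *\<^sub>R t \<bullet> \<xi>))
        + gauss_density \<xi> * ((A \<xi> - \<kappa>) * cos ((1/e) *\<^sub>R t \<bullet> \<xi>) + B \<xi> * sin ((1/e) *\<^sub>R t \<bullet> \<xi>))) / C"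
      unfolding 1 2 add_divide_distrib[symmetric] by (simp only: Bochner_Integration.integral_add)
    also have "\<dots> = (LINT \<xi>|lborel. (gauss_density \<xi> / C) * (A \<xi> * cos ((1/e) *\<^sub>R t \<bullet> \<xi>) + B \<xi> * sin ((1/e) *\<^sub>R t \<bullet> \<xi>)))"
      unfolding integral_divide_zero[symmetric]
    proof (rule Bochner_Integration.integral_cong[OF refl])
      show "(\<kappa> * (gauss_density \<xi> * c) + gauss_density \<xi> * ((A \<xi> - \<kappa>) * c + B \<xi> * s)) / C = (gauss_density \<xi> / C) * (A \<xi> * c + B \<xi> * s)" for \<xi> c s
        using C(1) by (simp add: field_simps)
    qed
    finally show ?thesis .
  qed
  have gi: "integrable lborel (\<lambda>t. ?g t)" using lborel_integrable_affine[OF gauss_density_integrable, of "1/e" 0] e by simp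
  have gI: "(LINT t|lborel. ?g t) = ?e"
    using lborel_integral_affine[where f="gauss_density :: 'a \<Rightarrow> real", OF gauss_density_measurable, of "1/e" 0] e by (simp add: power_one_over field_simps)
  have Vi: "integrable lborel ?V" by (rule integrable_gauss_average[OF W])
  let ?\<phi> = "\<lambda>p. f (fst p) * f (snd p)"
  have "0 \<le> (LINT p|(lborel \<Otimes>\<^sub>M lborel). (LINT \<xi>|lborel. (gauss_density \<xi> / C) * (A \<xi> * cos ((1/e) *\<^sub>R (fst p - snd p) \<bullet> \<xi>)
           + B \<xi> * sin ((1/e) *\<^sub>R (fst p - snd p) \<bullet> \<xi>))) * ?\<phi> p)"
  proof (rule form_positive_definite[where b="\<kappa> + (LINT u|lborel. \<bar>W u\<bar>)"])
    show "0 \<le> A \<xi>" for \<xi> unfolding A_def using sym[of "(1/e) *\<^sub>R \<xi>"] by simp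
    show "A \<xi> \<le> \<kappa> + (LINT u|lborel. \<bar>W u\<bar>)" for \<xi>
      using Ab[of \<xi>] by linarith
    show "\<bar>B \<xi>\<bar> \<le> \<kappa> + (LINT u|lborel. \<bar>W u\<bar>)" for \<xi>
      using Bb[of \<xi>] k by linarith
    show "0 \<le> gauss_density \<xi> / C" for \<xi> :: 'a using C(1) gauss_density_pos[of \<xi>] by simp
  qed (use f in simp_all)
  also have "\<dots> = (LINT p|(lborel \<Otimes>\<^sub>M lborel). \<kappa> * (?g (fst p - snd p) * ?\<phi> p) + ?e * (?V (fst p - snd p) * ?\<phi> p))"
    unfolding key[symmetric] by (simp add: distrib_right mult.assoc)
  also have "\<dots> = \<kappa> * (LINT p|(lborel \<Otimes>\<^sub>M lborel). ?g (fst p - snd p) * ?\<phi> p) + ?e * (LINT p|(lborel \<Otimes>\<^sub>M lborel). ?V (fst p - snd p) * ?\<phi> p)"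
    by (subst Bochner_Integration.integral_add; (intro integrable_mult_right integrable_lborel_form[OF gi f M] integrable_lborel_form[OF Vi f M])?) simp
  \<comment> \<open>The Gaussian that smears out the point mass has mass \<open>?e\<close>, so its
    form is at most \<open>?e\<close> times the squared norm. Since \<open>\<kappa>\<close> is
    nonnegative, restoring the point mass only increases the value.\<close>
  also have "\<dots> \<le> \<kappa> * (?e * (LINT x|lborel. (f x)\<^sup>2)) + ?e * (LINT p|(lborel \<Otimes>\<^sub>M lborel). ?V (fst p - snd p) * ?\<phi> p)"
    using convolution_form_le(1)[OF f M gi less_imp_le[OF gauss_density_pos]] k unfolding gI
    by (intro add_right_mono mult_left_mono)
  also have "\<dots> = ?e * (\<kappa> * (LINT x|lborel. (f x)\<^sup>2) + (LINT p|(lborel \<Otimes>\<^sub>M lborel). ?V (fst p - snd p) * ?\<phi> p))"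
    by (simp add: algebra_simps)
  finally show ?thesis
    using zero_less_power[OF e, of "DIM('a)"] by (auto simp only: zero_le_mult_iff dest: leD)
qed

text \<open>For widths 1 / (n + 1) the averages of W converge to W in L^1, and for bounded
  integrable f the form depends continuously on its kernel in L^1. So nonnegativity survives the
  removal of the Gaussian.\<close>

proposition form_nonneg_of_symbol_nonneg:
  fixes W f :: "'a::euclidean_space \<Rightarrow> real"
  assumes W: "integrable lborel W" and k: "0 \<le> \<kappa>"
    and sym: "\<And>\<xi>. 0 \<le> \<kappa> + (LINT u|lborel. W u * cos (u \<bullet> \<xi>))"
    and f: "integrable lborel f" and M: "\<And>x. \<bar>f x\<bar> \<le> M"
  shows "0 \<le> \<kappa> * (LINT x|lborel. (f x)\<^sup>2) + (LINT p|(lborel \<Otimes>\<^sub>M lborel). W (fst p - snd p) * (f (fst p) * f (snd p)))"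
proof -
  let ?V = "\<lambda>n t. LINT z|lborel. W (t - inverse (real (Suc n)) *\<^sub>R z) * gauss_density z"
  let ?\<phi> = "\<lambda>p. f (fst p) * f (snd p)"
  let ?B = "\<lambda>W. LINT p|(lborel \<Otimes>\<^sub>M lborel). W (fst p - snd p) * ?\<phi> p"
  have M0: "M \<ge> 0" using M[of 0] by linarith
  have Vi: "integrable lborel (?V n)" for n by (rule integrable_gauss_average[OF W])
  have bound: "\<bar>?B U\<bar> \<le> M * (LINT x|lborel. \<bar>U x\<bar>) * (LINT x|lborel. \<bar>f x\<bar>)" if U: "integrable lborel U" for U
  proof -
    have "\<bar>?B U\<bar> \<le> (LINT p|(lborel \<Otimes>\<^sub>M lborel). \<bar>U (fst p - snd p) * ?\<phi> p\<bar>)" by (rule integral_abs_bound)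
    also have "\<dots> \<le> (LINT p|(lborel \<Otimes>\<^sub>M lborel). M * (\<bar>U (fst p - snd p)\<bar> * \<bar>f (snd p)\<bar>))"
    proof (rule integral_mono[OF integrable_abs[OF integrable_lborel_form[OF U f M]]])
      show "integrable (lborel \<Otimes>\<^sub>M lborel) (\<lambda>p. M * (\<bar>U (fst p - snd p)\<bar> * \<bar>f (snd p)\<bar>))"
        using integrable_lborel_conv[OF integrable_abs[OF U] integrable_abs[OF f], of 1] by simp
      fix p
      have "\<bar>f (fst p)\<bar> * (\<bar>U (fst p - snd p)\<bar> * \<bar>f (snd p)\<bar>) \<le> M * (\<bar>U (fst p - snd p)\<bar> * \<bar>f (snd p)\<bar>)"
        using M by (intro mult_right_mono) auto
      then show "\<bar>U (fst p - snd p) * ?\<phi> p\<bar> \<le> M * (\<bar>U (fst p - snd p)\<bar> * \<bar>f (snd p)\<bar>)"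
        by (simp add: abs_mult mult_ac)
    qed
    also have "\<dots> = M * (LINT x|lborel. \<bar>U x\<bar>) * (LINT x|lborel. \<bar>f x\<bar>)"
      using integral_lborel_conv[OF integrable_abs[OF U] integrable_abs[OF f], of 1] by simp
    finally show ?thesis .
  qed
  have z1: "(\<lambda>n. M * (LINT t|lborel. \<bar>?V n t - W t\<bar>) * (LINT x|lborel. \<bar>f x\<bar>)) \<longlonglongrightarrow> 0"
    using gauss_average_tendsto_L1[OF W LIMSEQ_inverse_real_of_nat]
    by (intro tendsto_mult_left_zero tendsto_mult_right_zero)
  have z2: "\<bar>?B (?V n) - ?B W\<bar> \<le> M * (LINT t|lborel. \<bar>?V n t - W t\<bar>) * (LINT x|lborel. \<bar>f x\<bar>)" for n
  proof -
    have "?B (?V n) - ?B W = ?B (\<lambda>t. ?V n t - W t)"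
      by (subst Bochner_Integration.integral_diff[OF integrable_lborel_form[OF Vi f M] integrable_lborel_form[OF W f M], symmetric])
        (simp add: left_diff_distrib)
    then show ?thesis using bound[OF Bochner_Integration.integrable_diff[OF Vi W]] by simp
  qed
  have "(\<lambda>n. ?B (?V n) - ?B W) \<longlonglongrightarrow> 0"
    by (rule Lim_null_comparison[OF always_eventually z1]) (simp only: real_norm_def z2 simp_thms)
  then have "(\<lambda>n. \<kappa> * (LINT x|lborel. (f x)\<^sup>2) + ?B (?V n)) \<longlonglongrightarrow> \<kappa> * (LINT x|lborel. (f x)\<^sup>2) + ?B W"
    by (intro tendsto_intros) (rule LIM_zero_cancel)
  then show ?thesis
  proof (rule LIMSEQ_le_const)
    show "\<exists>N. \<forall>n\<ge>N. 0 \<le> \<kappa> * (LINT x|lborel. (f x)\<^sup>2) + ?B (?V n)"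
    proof (intro exI allI impI)
      show "0 \<le> \<kappa> * (LINT x|lborel. (f x)\<^sup>2) + ?B (?V n)" for n
        by (rule gauss_average_form_nonneg[OF W k sym f M]) simp
    qed
  qed
qed


section \<open>The symbol at high frequencies\<close>

text \<open>Translation by the half period h = pi \<xi> / |\<xi>|^2 flips the sign of the cosine, so
  twice the integral is the integral of (W(u) - W(u - h)) times the cosine. As h tends to 0, L^1
  continuity of translations finishes.\<close>

lemma Riemann_Lebesgue_cos:
  fixes W :: "'a::euclidean_space \<Rightarrow> real" and \<xi> :: "nat \<Rightarrow> 'a"
  assumes W: "integrable lborel W" and \<xi>: "filterlim (\<lambda>n. norm (\<xi> n)) at_top sequentially"
  shows "(\<lambda>n. LINT u|lborel. W u * cos (u \<bullet> \<xi> n)) \<longlonglongrightarrow> 0"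
proof -
  have Wm [measurable]: "W \<in> borel_measurable borel" using W by auto
  define h where "h n = (pi / (norm (\<xi> n))\<^sup>2) *\<^sub>R \<xi> n" for n
  have ev: "\<forall>\<^sub>F n in sequentially. \<xi> n \<noteq> 0"
    using filterlim_at_top_dense[of "\<lambda>n. norm (\<xi> n)"] \<xi> by (auto elim!: allE[of _ 0] eventually_mono)
  have "(\<lambda>n. norm (h n)) \<longlonglongrightarrow> 0"
  proof (rule Lim_transform_eventually)
    show "(\<lambda>n. pi / norm (\<xi> n)) \<longlonglongrightarrow> 0"
      by (rule real_tendsto_divide_at_top[OF tendsto_const \<xi>])
    show "\<forall>\<^sub>F n in sequentially. pi / norm (\<xi> n) = norm (h n)"
      using ev by eventually_elim (simp add: h_def power2_eq_square)
  qed
  then have h0: "h \<longlonglongrightarrow> 0" by (rule tendsto_norm_zero_cancel)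
  have i: "integrable lborel (\<lambda>u. V u * cos (u \<bullet> x))" if "integrable lborel V" for V :: "'a \<Rightarrow> real" and x
  proof (rule Bochner_Integration.integrable_bound[OF that])
    show "(\<lambda>u. V u * cos (u \<bullet> x)) \<in> borel_measurable lborel" using that by (auto intro!: borel_measurable_times)
  qed (simp add: abs_mult mult_left_le)
  show ?thesis
  proof (rule Lim_null_comparison[OF _ tendsto_translate_L1[OF W h0]])
    show "\<forall>\<^sub>F n in sequentially. norm (LINT u|lborel. W u * cos (u \<bullet> \<xi> n)) \<le> (LINT x|lborel. \<bar>W (x - h n) - W x\<bar>)"
      using ev
    proof eventually_elim
      case (elim n)
      let ?I = "LINT u|lborel. W u * cos (u \<bullet> \<xi> n)"
      have m: "(\<lambda>u. W u * cos (u \<bullet> \<xi> n)) \<in> borel_measurable borel" by measurable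
      have "h n \<bullet> \<xi> n = pi" unfolding h_def using elim by (simp add: power2_norm_eq_inner)
      then have "?I = (LINT u|lborel. - (W (u - h n) * cos (u \<bullet> \<xi> n)))"
        by (subst lborel_integral_shift[OF m, of "h n", symmetric]) (simp add: inner_diff_left)
      then have "2 * ?I = ?I + (LINT u|lborel. - (W (u - h n) * cos (u \<bullet> \<xi> n)))" by simp
      also have "\<dots> = (LINT u|lborel. (W u - W (u - h n)) * cos (u \<bullet> \<xi> n))"
        using i[OF W] i[OF lborel_integrable_shift[OF W]] by (simp add: left_diff_distrib)
      finally have "\<bar>2 * ?I\<bar> \<le> (LINT u|lborel. \<bar>(W u - W (u - h n)) * cos (u \<bullet> \<xi> n)\<bar>)"
        by (simp only: integral_abs_bound)
      also have "\<dots> \<le> (LINT x|lborel. \<bar>W (x - h n) - W x\<bar>)"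
        using W lborel_integrable_shift[OF W]
        by (intro integral_mono integrable_abs i Bochner_Integration.integrable_diff) (auto simp: abs_mult abs_minus_commute mult_left_le)
      finally show ?case by simp
    qed
  qed
qed

text \<open>If the integral vanished, the cosine would equal 1 almost everywhere on U, hence
  everywhere there, because an open null set is empty. But moving a point of U a little in the
  direction \<xi> changes the phase.\<close>

lemma symbol_pos:
  fixes K :: "'a::euclidean_space \<Rightarrow> real"
  assumes K: "integrable lborel K" "\<And>z. 0 \<le> K z" and U: "open U" "U \<noteq> {}" "AE z in lborel. z \<in> U \<longrightarrow> 0 < K z"
    and "\<xi> \<noteq> 0"
  shows "0 < (LINT z|lborel. (1 - cos (z \<bullet> \<xi>)) * K z)"
proof (rule ccontr)
  have Km [measurable]: "K \<in> borel_measurable borel" using K by auto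
  assume "\<not> ?thesis"
  then have 0: "(LINT z|lborel. (1 - cos (z \<bullet> \<xi>)) * K z) = 0"
    by (intro antisym integral_nonneg_AE) (simp_all add: not_less K(2))
  have "\<bar>1 - cos t\<bar> \<le> 2" for t :: real using cos_ge_minus_one[of t] by (simp add: abs_le_iff)
  then have i: "integrable lborel (\<lambda>z. (1 - cos (z \<bullet> \<xi>)) * K z)"
    by (intro Bochner_Integration.integrable_bound[OF integrable_mult_right[OF K(1), of 2]])
      (auto simp: abs_mult intro!: mult_right_mono)
  have "AE z in lborel. (1 - cos (z \<bullet> \<xi>)) * K z = 0"
    using integral_nonneg_eq_0_iff_AE[OF i] 0 K(2) by simp
  with U(3) have ae: "AE z in lborel. z \<notin> {z \<in> U. cos (z \<bullet> \<xi>) \<noteq> 1}"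
    by eventually_elim auto
  have op: "open {z \<in> U. cos (z \<bullet> \<xi>) \<noteq> 1}"
  proof -
    have "{z \<in> U. cos (z \<bullet> \<xi>) \<noteq> 1} = U \<inter> (\<lambda>z. cos (z \<bullet> \<xi>)) -` (- {1})" by auto
    moreover have "open ((\<lambda>z. cos (z \<bullet> \<xi>)) -` (- {1}))"
      by (intro open_vimage continuous_intros)
    ultimately show ?thesis using U(1) by (simp only: open_Int)
  qed
  have "{z \<in> U. cos (z \<bullet> \<xi>) \<noteq> 1} \<in> null_sets lborel"
    using ae op AE_iff_null_sets[of "{z \<in> U. cos (z \<bullet> \<xi>) \<noteq> 1}" lborel] by auto
  then have "negligible {z \<in> U. cos (z \<bullet> \<xi>) \<noteq> 1}"
    unfolding negligible_iff_null_sets by (rule null_sets_completionI)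
  then have one: "\<And>z. z \<in> U \<Longrightarrow> cos (z \<bullet> \<xi>) = 1" using open_not_negligible[OF op] by blast
  obtain z0 where z0: "z0 \<in> U" using U(2) by auto
  obtain \<tau> where \<tau>: "\<tau> > 0" "ball z0 \<tau> \<subseteq> U" using U(1) z0 openE by blast
  \<comment> \<open>The first bound keeps z0 + t \<xi> in the ball inside U; the second keeps the
    change of phase t |\<xi>|^2 in (0, 1], where the cosine is below 1.\<close>
  define t where "t = min (\<tau> / (2 * norm \<xi>)) (1 / (norm \<xi>)\<^sup>2)"
  have t: "t > 0" "t * norm \<xi> < \<tau>" "t * (norm \<xi>)\<^sup>2 \<le> 1"
  proof -
    show "t > 0" unfolding t_def using \<tau> \<open>\<xi> \<noteq> 0\<close> by auto
    have "t * norm \<xi> \<le> \<tau> / (2 * norm \<xi>) * norm \<xi>" unfolding t_def by (intro mult_right_mono) auto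
    then show "t * norm \<xi> < \<tau>" using \<tau> \<open>\<xi> \<noteq> 0\<close> by simp
    have "t * (norm \<xi>)\<^sup>2 \<le> 1 / (norm \<xi>)\<^sup>2 * (norm \<xi>)\<^sup>2" unfolding t_def by (intro mult_right_mono) auto
    then show "t * (norm \<xi>)\<^sup>2 \<le> 1" using \<open>\<xi> \<noteq> 0\<close> by simp
  qed
  have "z0 + t *\<^sub>R \<xi> \<in> U" using \<tau> t by (auto simp: dist_norm intro!: subsetD[OF \<tau>(2)])
  then have 1: "cos (z0 \<bullet> \<xi> + t * (norm \<xi>)\<^sup>2) = 1"
    using one[of "z0 + t *\<^sub>R \<xi>"] by (simp add: inner_add_left power2_norm_eq_inner)
  have "cos (z0 \<bullet> \<xi>) = 1" "sin (z0 \<bullet> \<xi>) = 0" using one[OF z0] sin_cos_squared_add[of "z0 \<bullet> \<xi>"] by auto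
  then have "cos (t * (norm \<xi>)\<^sup>2) = 1" using 1 by (simp add: cos_add)
  moreover have "cos (t * (norm \<xi>)\<^sup>2) < cos 0"
    using t \<open>\<xi> \<noteq> 0\<close> pi_gt3 by (intro cos_monotone_0_pi) auto
  ultimately show False by simp
qed

text \<open>The Riemann-Lebesgue lemma makes the symbol tend to the total mass of K at infinity,
  which gives half the mass outside some ball. On the remaining compact shell the symbol is
  continuous and positive.\<close>

lemma symbol_bounded_below:
  fixes K :: "'a::euclidean_space \<Rightarrow> real"
  assumes K: "integrable lborel K" "\<And>z. 0 \<le> K z" and U: "open U" "U \<noteq> {}" "AE z in lborel. z \<in> U \<longrightarrow> 0 < K z"
  shows "\<exists>c>0. \<forall>\<xi>. 1 \<le> norm \<xi> \<longrightarrow> c \<le> (LINT z|lborel. (1 - cos (z \<bullet> \<xi>)) * K z)"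
proof -
  have Km [measurable]: "K \<in> borel_measurable borel" using K by auto
  let ?k = "\<lambda>\<xi>. LINT z|lborel. (1 - cos (z \<bullet> \<xi>)) * K z"
  have i: "integrable lborel (\<lambda>z. K z * cos (z \<bullet> \<xi>))" for \<xi>
    by (rule Bochner_Integration.integrable_bound[OF K(1)]) (auto simp: abs_mult mult_left_le)
  have split: "(1 - cos (z \<bullet> \<xi>)) * K z = K z - K z * cos (z \<bullet> \<xi>)" for z \<xi> by (simp add: algebra_simps)
  have k: "?k \<xi> = (LINT z|lborel. K z) - (LINT z|lborel. K z * cos (z \<bullet> \<xi>))" for \<xi>
    unfolding split using i[of \<xi>] K(1) by simp
  have pos: "0 < ?k \<xi>" if "\<xi> \<noteq> 0" for \<xi> using symbol_pos[OF K U that] .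
  let ?I = "LINT z|lborel. K z"
  obtain b :: 'a where b: "b \<in> Basis" using nonempty_Basis by blast
  have I0: "?I > 0"
  proof -
    have "0 < ?k b" using b by (intro pos) auto
    also have "?k b \<le> (LINT z|lborel. 2 * K z)"
    proof (rule integral_mono)
      show "integrable lborel (\<lambda>z. (1 - cos (z \<bullet> b)) * K z)" unfolding split using i[of b] K(1) by simp
      show "(1 - cos (z \<bullet> b)) * K z \<le> 2 * K z" for z
        using cos_ge_minus_one[of "z \<bullet> b"] K(2)[of z] by (intro mult_right_mono) auto
    qed (use K in auto)
    finally show ?thesis by simp
  qed
  have "\<exists>R. \<forall>\<xi>. norm \<xi> \<ge> R \<longrightarrow> ?I / 2 \<le> ?k \<xi>"
  proof (rule ccontr)
    assume "\<not> ?thesis"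
    then have "\<forall>n::nat. \<exists>\<xi>. norm \<xi> \<ge> real n \<and> ?k \<xi> < ?I / 2" by (meson not_le)
    then obtain \<xi> where \<xi>: "\<And>n. norm (\<xi> n) \<ge> real n" "\<And>n. ?k (\<xi> n) < ?I / 2" by metis
    have "filterlim (\<lambda>n. norm (\<xi> n)) at_top sequentially"
      by (rule filterlim_at_top_mono[OF filterlim_real_sequentially]) (use \<xi>(1) in auto)
    from Riemann_Lebesgue_cos[OF K(1) this]
    have "(\<lambda>n. ?k (\<xi> n)) \<longlonglongrightarrow> ?I - 0" unfolding k by (intro tendsto_intros)
    then have "?I - 0 \<le> ?I / 2" by (rule LIMSEQ_le_const2) (use \<xi>(2) less_imp_le in blast)
    with I0 show False by simp
  qed
  then obtain R where R: "\<And>\<xi>. norm \<xi> \<ge> R \<Longrightarrow> ?I / 2 \<le> ?k \<xi>" by blast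
  have cont: "continuous_on UNIV ?k"
  proof (rule continuous_on_sequentiallyI)
    fix u :: "nat \<Rightarrow> 'a" and a assume u: "u \<longlonglongrightarrow> a"
    have "(\<lambda>n. LINT z|lborel. K z * cos (z \<bullet> u n)) \<longlonglongrightarrow> (LINT z|lborel. K z * cos (z \<bullet> a))"
    proof (rule integral_dominated_convergence[where w=K])
      show "AE z in lborel. (\<lambda>n. K z * cos (z \<bullet> u n)) \<longlonglongrightarrow> K z * cos (z \<bullet> a)"
        by (intro AE_I2 tendsto_intros u)
    qed (use K in \<open>auto simp: abs_mult mult_left_le\<close>)
    then show "(\<lambda>n. ?k (u n)) \<longlonglongrightarrow> ?k a" unfolding k by (intro tendsto_intros)
  qed
  \<comment> \<open>R may be below 1; the maximum keeps the shell nonempty, so that the minimum is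
    attained.\<close>
  define S where "S = {\<xi>::'a. 1 \<le> norm \<xi> \<and> norm \<xi> \<le> max 1 R}"
  have "S = cball 0 (max 1 R) - ball 0 1" unfolding S_def by (auto simp: dist_norm)
  then have "compact S" by (simp add: compact_diff)
  moreover have "b \<in> S" using b unfolding S_def by simp
  ultimately obtain x where x: "x \<in> S" "\<And>y. y \<in> S \<Longrightarrow> ?k x \<le> ?k y"
    using continuous_attains_inf[of S ?k] continuous_on_subset[OF cont] by blast
  have "x \<noteq> 0" using x(1) unfolding S_def by auto
  show ?thesis
  proof (intro exI conjI allI impI)
    show "min (?k x) (?I / 2) > 0" using pos[OF \<open>x \<noteq> 0\<close>] I0 by simp
    show "min (?k x) (?I / 2) \<le> ?k \<xi>" if "1 \<le> norm \<xi>" for \<xi>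
    proof (cases "norm \<xi> \<ge> R")
      case True
      then show ?thesis using R[of \<xi>] by linarith
    next
      case False
      then have "\<xi> \<in> S" using that unfolding S_def by auto
      then show ?thesis using x(2)[of \<xi>] by linarith
    qed
  qed
qed


section \<open>The averaged form bounded by the L^r norm\<close>

text \<open>Integrated against a probability kernel with the optimal \<open>S\<close>, this pointwise bound replaces
  Young's convolution inequality.\<close>

lemma mult_le_powr_combination:
  fixes a b S r :: real
  assumes "0 \<le> a" "0 \<le> b" "0 < S" "1 < r" "r < 2"
  shows "a * b \<le> S * (a powr r * b powr r) + S powr (- ((2 - r) / (2 * (r - 1)))) * ((a powr r + b powr r) / 2)"
proof (cases "a * b = 0")
  case False
  then have ab: "a > 0" "b > 0" using assms by (auto simp: less_le)
  define t where "t = a * b"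
  have t: "t > 0" using ab by (simp add: t_def)
  have tr: "a powr r * b powr r = t powr r" using ab by (simp add: t_def powr_mult)
  \<comment> \<open>If S t^(r-1) \<ge> 1, then t is at most S t^r. Otherwise t is small, and the
    exponent of S is chosen so that t^(r-1) \<le> 1 / S becomes a bound on t^(1-r/2); the remaining
    factor t^(r/2) goes to the mean of the two r-th powers.\<close>
  show ?thesis
  proof (cases "S * t powr (r - 1) \<ge> 1")
    case True
    have "t \<le> t * (S * t powr (r - 1))" using True t by simp
    also have "\<dots> = S * t powr r" using t by (simp add: powr_diff)
    finally show ?thesis unfolding tr t_def[symmetric] by (rule order_trans) simp
  next
    case False
    then have "t powr (r - 1) \<le> 1 / S" using assms(3) by (simp add: field_simps)
    then have "(t powr (r - 1)) powr ((2 - r) / (2 * (r - 1))) \<le> (1 / S) powr ((2 - r) / (2 * (r - 1)))"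
      using assms by (intro powr_mono2) auto
    then have 1: "t powr (1 - r / 2) \<le> S powr (- ((2 - r) / (2 * (r - 1))))"
    proof -
      have "(r - 1) * ((2 - r) / (2 * (r - 1))) = 1 - r / 2" using assms(4) by (simp add: field_simps)
      then show ?thesis
        using assms(3) \<open>(t powr (r - 1)) powr _ \<le> _\<close> by (simp only: powr_powr) (simp add: powr_minus_divide powr_divide)
    qed
    have "t powr (r / 2) = a powr (r / 2) * b powr (r / 2)" using ab by (simp add: t_def powr_mult)
    also have "\<dots> \<le> ((a powr (r / 2))\<^sup>2 + (b powr (r / 2))\<^sup>2) / 2"
      using sum_squares_bound[of "a powr (r/2)" "b powr (r/2)"] by simp
    also have "\<dots> = (a powr r + b powr r) / 2" using ab by (simp add: power2_eq_square powr_add[symmetric])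
    finally have 2: "t powr (r / 2) \<le> (a powr r + b powr r) / 2" .
    have "t = t powr (1 - r / 2) * t powr (r / 2)" using t by (simp add: powr_add[symmetric])
    also have "\<dots> \<le> S powr (- ((2 - r) / (2 * (r - 1)))) * ((a powr r + b powr r) / 2)"
      using 1 2 by (intro mult_mono) auto
    also have "\<dots> \<le> S * (a powr r * b powr r) + \<dots>" using assms(3) by simp
    finally show ?thesis unfolding t_def[symmetric] .
  qed
qed (use assms in auto)

text \<open>The product term of \<open>mult_le_powr_combination\<close> is paired with the bound
  \<rho> \<le> L, the mean term with the unit mass of \<rho>. X is only an upper bound for the
  integral, so that one X serves all clippings of a function.\<close>

lemma form_le_Lr_norm:
  fixes f \<rho> :: "'a::euclidean_space \<Rightarrow> real"
  assumes f: "integrable lborel f" "\<And>x. \<bar>f x\<bar> \<le> M" and r: "1 < r" "r < 2"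
    and fr: "integrable lborel (\<lambda>x. \<bar>f x\<bar> powr r)" "(LINT x|lborel. \<bar>f x\<bar> powr r) \<le> X" "0 < X"
    and \<rho>: "integrable lborel \<rho>" "\<And>x. 0 \<le> \<rho> x" "\<And>x. \<rho> x \<le> L" "(LINT x|lborel. \<rho> x) = 1" "0 < L"
  shows "(LINT p|(lborel \<Otimes>\<^sub>M lborel). \<rho> (fst p - snd p) * (f (fst p) * f (snd p))) \<le> 2 * L powr ((2 - r) / r) * X powr (2 / r)"
proof -
  define q where "q = (2 - r) / (2 * (r - 1))"
  \<comment> \<open>The solution of S L X^2 = S^(-q) X, which balances the two terms; their equality
    gives the factor 2 of the conclusion.\<close>
  define S where "S = (L * X) powr (- (2 * (r - 1) / r))"
  have S: "S > 0" using \<rho> fr unfolding S_def by simp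
  let ?h = "\<lambda>x. \<bar>f x\<bar> powr r" and ?P = "lborel \<Otimes>\<^sub>M (lborel :: 'a measure)"
  let ?Y = "LINT x|lborel. ?h x"
  have Y0: "0 \<le> ?Y" by simp
  have [measurable]: "f \<in> borel_measurable borel" "\<rho> \<in> borel_measurable borel" using f \<rho> by auto
  have i: "integrable ?P (\<lambda>p. S * L * (?h (fst p) * ?h (snd p)) + (S powr (- q) / 2) * (\<rho> (fst p - snd p) * ?h (fst p) + \<rho> (fst p - snd p) * ?h (snd p)))"
    using integrable_lborel_conv[OF \<rho>(1) fr(1), of 1]
    by (intro Bochner_Integration.integrable_add integrable_mult_right integrable_lborel_pair_mult fr(1)
        integrable_lborel_conv_fst \<rho>(1)) simp
  have "(LINT p|?P. \<rho> (fst p - snd p) * (f (fst p) * f (snd p)))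
     \<le> (LINT p|?P. S * L * (?h (fst p) * ?h (snd p)) + (S powr (- q) / 2) * (\<rho> (fst p - snd p) * ?h (fst p) + \<rho> (fst p - snd p) * ?h (snd p)))"
  proof (rule integral_mono[OF integrable_lborel_form[OF \<rho>(1) f] i])
    fix p :: "'a \<times> 'a"
    obtain x y where p: "p = (x, y)" by (cases p)
    have "f x * f y \<le> \<bar>f x\<bar> * \<bar>f y\<bar>" by (simp add: abs_mult[symmetric])
    also have "\<dots> \<le> S * (?h x * ?h y) + S powr (- q) * ((?h x + ?h y) / 2)"
      unfolding q_def by (rule mult_le_powr_combination) (use r S in auto)
    finally have "\<rho> (x - y) * (f x * f y) \<le> \<rho> (x - y) * (S * (?h x * ?h y) + S powr (- q) * ((?h x + ?h y) / 2))"
      using \<rho>(2) by (rule mult_left_mono)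
    also have "\<dots> = \<rho> (x - y) * (S * (?h x * ?h y)) + (S powr (- q) / 2) * (\<rho> (x - y) * ?h x + \<rho> (x - y) * ?h y)"
      by (simp add: algebra_simps add_divide_distrib)
    also have "\<rho> (x - y) * (S * (?h x * ?h y)) \<le> L * (S * (?h x * ?h y))"
      using \<rho>(3) S by (intro mult_right_mono) auto
    finally show "\<rho> (fst p - snd p) * (f (fst p) * f (snd p)) \<le> S * L * (?h (fst p) * ?h (snd p)) + (S powr (- q) / 2) * (\<rho> (fst p - snd p) * ?h (fst p) + \<rho> (fst p - snd p) * ?h (snd p))"
      by (simp add: p mult_ac)
  qed
  also have "\<dots> = S * L * (?Y * ?Y) + S powr (- q) * ?Y"
    using integrable_lborel_conv[OF \<rho>(1) fr(1), of 1] integral_lborel_conv[OF \<rho>(1) fr(1), of 1]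
      integrable_lborel_conv_fst[OF \<rho>(1) fr(1)] integral_lborel_conv_fst[OF \<rho>(1) fr(1)]
      integrable_lborel_pair_mult[OF fr(1) fr(1)] integral_lborel_pair_mult[OF fr(1) fr(1)] \<rho>(4) by simp
  also have "\<dots> \<le> S * L * (X * X) + S powr (- q) * X"
    using S \<rho> fr Y0 by (intro add_mono mult_left_mono mult_mono) auto
  also have "S * L * (X * X) = L powr ((2 - r) / r) * X powr (2 / r)"
  proof -
    have "S * L * (X * X) = (L powr (- (2 * (r - 1) / r)) * L powr 1) * (X powr (- (2 * (r - 1) / r)) * X powr 2)"
      unfolding S_def using fr \<rho> by (simp add: powr_mult powr_numeral power2_eq_square)
    also have "\<dots> = L powr ((2 - r) / r) * X powr (2 / r)"
      unfolding powr_add[symmetric] using r by (simp add: field_simps)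
    finally show ?thesis .
  qed
  also have "S powr (- q) * X = L powr ((2 - r) / r) * X powr (2 / r)"
  proof -
    have "S powr (- q) = (L * X) powr ((2 - r) / r)"
    proof -
      have "- (2 * (r - 1) / r) * - q = (2 - r) / r" unfolding q_def using r(1) by simp
      then show ?thesis unfolding S_def powr_powr by (simp only:)
    qed
    then have "S powr (- q) * X = L powr ((2 - r) / r) * (X powr ((2 - r) / r) * X powr 1)"
      using fr \<rho> by (simp add: powr_mult)
    also have "\<dots> = L powr ((2 - r) / r) * X powr (2 / r)"
      unfolding powr_add[symmetric] using r by (simp add: field_simps)
    finally show ?thesis .
  qed
  finally show ?thesis by (simp only: mult_2 distrib_right)
qed


section \<open>Nash inequality\<close>

lemma one_minus_cos_le: "1 - cos (t::real) \<le> t\<^sup>2 / 2"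
proof -
  have "1 - cos t = 2 * (sin (t / 2))\<^sup>2" using cos_double_sin[of "t / 2"] by simp
  also have "\<dots> \<le> 2 * (t / 2)\<^sup>2"
    using power_mono[OF abs_sin_x_le_abs_x[of "t/2"], of 2] by (simp add: power_divide)
  finally show ?thesis by (simp add: power2_eq_square)
qed

text \<open>Here integrability of the kernel is essential: for a kernel with infinite mass the two
  terms of the difference need not be finite.\<close>

lemma square_diff_form_eq:
  fixes K f :: "'a::euclidean_space \<Rightarrow> real"
  assumes K: "integrable lborel K" and f: "integrable lborel f" "\<And>x. \<bar>f x\<bar> \<le> M"
  shows "(LINT p|(lborel \<Otimes>\<^sub>M lborel). (f (fst p) - f (snd p))\<^sup>2 * K (fst p - snd p))
    = 2 * ((LINT x|lborel. K x) * (LINT x|lborel. (f x)\<^sup>2) - (LINT p|(lborel \<Otimes>\<^sub>M lborel). K (fst p - snd p) * (f (fst p) * f (snd p))))"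
proof -
  have f2: "integrable lborel (\<lambda>x. (f x)\<^sup>2)"
    by (rule convolution_form_le(2)[OF f gauss_density_integrable less_imp_le[OF gauss_density_pos]])
  have "(f (fst p) - f (snd p))\<^sup>2 * K (fst p - snd p) = K (fst p - snd p) * (f (fst p))\<^sup>2 + K (fst p - snd p) * (f (snd p))\<^sup>2
     - 2 * (K (fst p - snd p) * (f (fst p) * f (snd p)))" for p
    by (simp add: power2_eq_square algebra_simps)
  then show ?thesis
    using integrable_lborel_conv_fst[OF K f2] integral_lborel_conv_fst[OF K f2] integrable_lborel_conv[OF K f2, of 1]
      integral_lborel_conv[OF K f2, of 1] integrable_lborel_form[OF K f] by simp
qed

text \<open>The squared norm is split into the averaged part, bounded by
  \<open>form_le_Lr_norm\<close>, and the oscillation f - \<rho> * f, which the form of K controls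
  because 1 minus the transform of \<rho> is at most \<open>D\<close> times the symbol of K.\<close>

lemma Nash_inequality_bounded:
  fixes K f :: "'a::euclidean_space \<Rightarrow> real"
  assumes K: "integrable lborel K" "\<And>z. 0 \<le> K z" and c: "0 < c" and \<gamma>: "0 < \<gamma>" "\<gamma> \<le> 2"
    and low: "\<And>\<xi>. norm \<xi> \<le> 1 \<Longrightarrow> c * norm \<xi> powr \<gamma> \<le> (LINT z|lborel. (1 - cos (z \<bullet> \<xi>)) * K z)"
    and high: "\<And>\<xi>. 1 \<le> norm \<xi> \<Longrightarrow> c \<le> (LINT z|lborel. (1 - cos (z \<bullet> \<xi>)) * K z)"
    and f: "integrable lborel f" "\<And>x. \<bar>f x\<bar> \<le> M" and r: "1 < r" "r < 2"
    and fr: "integrable lborel (\<lambda>x. \<bar>f x\<bar> powr r)" "(LINT x|lborel. \<bar>f x\<bar> powr r) \<le> X" "0 < X"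
    and R: "0 < R" "R \<le> 1"
  shows "(LINT x|lborel. (f x)\<^sup>2) \<le> R powr (-\<gamma>) / c * (LINT p|(lborel \<Otimes>\<^sub>M lborel). (f (fst p) - f (snd p))\<^sup>2 * K (fst p - snd p))
     + 2 * (R ^ DIM('a) / unit_ball_vol DIM('a)) powr ((2 - r) / r) * X powr (2 / r)"
proof -
  have [measurable]: "K \<in> borel_measurable borel" "f \<in> borel_measurable borel" using K f by auto
  define w where "w = measure lborel (ball (0::'a) (1 / R))"
  have w: "w = unit_ball_vol DIM('a) / R ^ DIM('a)"
    unfolding w_def using R by (subst content_ball) (auto simp: power_divide)
  have w0: "w > 0" unfolding w using R by simp
  define \<rho> where "\<rho> z = indicator (ball (0::'a) (1 / R)) z / w" for z
  have \<rho>i: "integrable lborel \<rho>" unfolding \<rho>_def using emeasure_lborel_ball_finite[of "0::'a" "1/R"] by simp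
  have \<rho>1: "(LINT x|lborel. \<rho> x) = 1" unfolding \<rho>_def using w0 by (simp add: w_def)
  have \<rho>0: "0 \<le> \<rho> z" "\<rho> z \<le> R ^ DIM('a) / unit_ball_vol DIM('a)" for z
    using w0 R unfolding \<rho>_def by (auto simp: w indicator_def)
  \<comment> \<open>The 2 comes from 1 - cos \<le> 2, and 1 / c from the lower bounds on the symbol
    of K.\<close>
  define D where "D = 2 / c * R powr (- \<gamma>)"
  have D0: "D > 0" unfolding D_def using c R by simp
  have R1: "R powr (-\<gamma>) \<ge> 1" using R \<gamma> by (simp add: powr_minus one_le_inverse powr_le1)
  let ?k = "\<lambda>K \<xi>. LINT z|lborel. (1 - cos (z \<bullet> \<xi>)) * K z"
  have icos: "integrable lborel (\<lambda>z. G z * cos (z \<bullet> \<xi>))" if "integrable lborel G" for G :: "'a \<Rightarrow> real" and \<xi>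
  proof (rule Bochner_Integration.integrable_bound[OF that])
    have [measurable]: "G \<in> borel_measurable borel" using that by auto
    show "(\<lambda>z. G z * cos (z \<bullet> \<xi>)) \<in> borel_measurable lborel" by measurable
  qed (auto simp: abs_mult mult_left_le)
  have split: "(1 - cos (z \<bullet> \<xi>)) * G z = G z - G z * cos (z \<bullet> \<xi>)" for z \<xi> and G :: "'a \<Rightarrow> real"
    by (simp add: algebra_simps)
  have ki: "integrable lborel (\<lambda>z. (1 - cos (z \<bullet> \<xi>)) * G z)"
    and k: "?k G \<xi> = (LINT z|lborel. G z) - (LINT z|lborel. G z * cos (z \<bullet> \<xi>))" if "integrable lborel G" for G :: "'a \<Rightarrow> real" and \<xi>
    unfolding split using that icos[OF that] by simp_all
  have k2: "?k G \<xi> \<le> 2 * (LINT z|lborel. G z)" if G: "integrable lborel G" "\<And>z. 0 \<le> G z" for G :: "'a \<Rightarrow> real" and \<xi>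
  proof -
    have "?k G \<xi> \<le> (LINT z|lborel. 2 * G z)"
    proof (rule integral_mono[OF ki[OF G(1)]])
      show "(1 - cos (z \<bullet> \<xi>)) * G z \<le> 2 * G z" for z
        using cos_ge_minus_one[of "z \<bullet> \<xi>"] G(2)[of z] by (intro mult_right_mono) auto
    qed (use G in auto)
    then show ?thesis by simp
  qed
  have krho: "?k \<rho> \<xi> \<le> (norm \<xi> / R)\<^sup>2" for \<xi>
  proof -
    have "?k \<rho> \<xi> \<le> (LINT z|lborel. (norm \<xi> / R)\<^sup>2 * \<rho> z)"
    proof (rule integral_mono[OF ki[OF \<rho>i]])
      show "(1 - cos (z \<bullet> \<xi>)) * \<rho> z \<le> (norm \<xi> / R)\<^sup>2 * \<rho> z" for z
      proof (cases "norm z < 1 / R")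
        case True
        have "\<bar>z \<bullet> \<xi>\<bar> \<le> norm z * norm \<xi>" by (rule Cauchy_Schwarz_ineq2)
        also have "\<dots> \<le> 1 / R * norm \<xi>" using True by (intro mult_right_mono) auto
        finally have "\<bar>z \<bullet> \<xi>\<bar>\<^sup>2 \<le> (norm \<xi> / R)\<^sup>2" using power_mono[of "\<bar>z \<bullet> \<xi>\<bar>" "norm \<xi> / R" 2] by simp
        then have "1 - cos (z \<bullet> \<xi>) \<le> (norm \<xi> / R)\<^sup>2"
          using one_minus_cos_le[of "z \<bullet> \<xi>"] zero_le_power2[of "z \<bullet> \<xi>"] unfolding power2_abs by linarith
        then show ?thesis using \<rho>0 by (intro mult_right_mono) auto
      qed (simp add: \<rho>_def)
    qed (use \<rho>i in simp)
    then show ?thesis using \<rho>1 by simp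
  qed
  \<comment> \<open>Three regimes: up to R the quadratic bound \<open>krho\<close> is at most
    (|\<xi>| / R)^\<gamma> since \<gamma> \<le> 2; between R and 1 the trivial bound 2 suffices as
    |\<xi>| / R > 1; beyond 1 it suffices because \<open>R powr (-\<gamma>)\<close> is at least
    1.\<close>
  have le: "?k \<rho> \<xi> \<le> D * ?k K \<xi>" for \<xi>
  proof (cases "norm \<xi> \<le> 1")
    case True
    have "?k \<rho> \<xi> \<le> 2 * (norm \<xi> / R) powr \<gamma>"
    proof (cases "\<xi> = 0")
      case False
      show ?thesis
      proof (cases "norm \<xi> \<le> R")
        case True
        have "?k \<rho> \<xi> \<le> (norm \<xi> / R) powr 2"
          using krho[of \<xi>] False R by (subst powr_numeral) auto
        also have "\<dots> \<le> (norm \<xi> / R) powr \<gamma>" using True False R \<gamma> by (intro powr_mono') auto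
        finally show ?thesis by (smt (verit) powr_ge_zero)
      next
        case False
        have "?k \<rho> \<xi> \<le> 2 * 1" using k2[OF \<rho>i \<rho>0(1), of \<xi>] \<rho>1 by simp
        also have "\<dots> \<le> 2 * (norm \<xi> / R) powr \<gamma>"
          using False R \<gamma> by (intro mult_left_mono ge_one_powr_ge_zero) auto
        finally show ?thesis .
      qed
    qed simp
    also have "\<dots> = D * (c * norm \<xi> powr \<gamma>)" unfolding D_def using R c by (simp add: powr_divide powr_minus_divide)
    also have "\<dots> \<le> D * ?k K \<xi>" using low[OF True] D0 by (intro mult_left_mono) auto
    finally show ?thesis .
  next
    case False
    have "?k \<rho> \<xi> \<le> 2 * 1" using k2[OF \<rho>i \<rho>0(1), of \<xi>] \<rho>1 by simp
    also have "\<dots> \<le> 2 * R powr (-\<gamma>)" using R1 by simp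
    also have "\<dots> = D * c" unfolding D_def using c by simp
    also have "\<dots> \<le> D * ?k K \<xi>" using high[of \<xi>] False D0 by (intro mult_left_mono) auto
    finally show ?thesis .
  qed
  let ?IK = "LINT z|lborel. K z" and ?F = "LINT x|lborel. (f x)\<^sup>2"
  let ?B = "\<lambda>G. LINT p|(lborel \<Otimes>\<^sub>M lborel). G (fst p - snd p) * (f (fst p) * f (snd p))"
  \<comment> \<open>The weight of the point mass. The symbol of K never exceeds twice the mass of K,
    so its lower bound c at a unit vector bounds the mass from below.\<close>
  have \<kappa>: "0 \<le> D * ?IK - 1"
  proof -
    obtain b :: 'a where b: "b \<in> Basis" using nonempty_Basis by blast
    have "c \<le> 2 * ?IK" using high[of b] k2[OF K, of b] b by simp
    then have "1 \<le> 2 / c * ?IK" using c by (simp add: field_simps)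
    also have "\<dots> \<le> D * ?IK" 
      unfolding D_def using mult_left_mono[OF R1, of "2 / c"] c K by (intro mult_right_mono) auto
    finally show ?thesis by simp
  qed
  \<comment> \<open>\<open>le\<close> says that the distribution \<open>(D * ?IK - 1) \<delta>\<^sub>0 + \<rho> - D * K\<close> has a nonnegative Fourier transform.\<close>
  have "0 \<le> (D * ?IK - 1) * ?F + ?B (\<lambda>z. \<rho> z - D * K z)"
  proof (rule form_nonneg_of_symbol_nonneg[OF _ \<kappa> _ f])
    show "integrable lborel (\<lambda>z. \<rho> z - D * K z)" using K \<rho>i by simp
    fix \<xi>
    have "(LINT u|lborel. (\<rho> u - D * K u) * cos (u \<bullet> \<xi>)) = (LINT u|lborel. \<rho> u * cos (u \<bullet> \<xi>)) - D * (LINT u|lborel. K u * cos (u \<bullet> \<xi>))"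
      using icos[OF K(1)] icos[OF \<rho>i] by (simp add: left_diff_distrib mult.assoc)
    then show "0 \<le> D * ?IK - 1 + (LINT u|lborel. (\<rho> u - D * K u) * cos (u \<bullet> \<xi>))"
      using le[of \<xi>] unfolding k[OF K(1)] k[OF \<rho>i] \<rho>1 by (simp add: algebra_simps)
  qed
  also have "?B (\<lambda>z. \<rho> z - D * K z) = ?B \<rho> - D * ?B K"
    using integrable_lborel_form[OF \<rho>i f] integrable_lborel_form[OF K(1) f] by (simp add: left_diff_distrib mult.assoc)
  finally have "?F \<le> D * (?IK * ?F - ?B K) + ?B \<rho>" by (simp add: algebra_simps)
  also have "?B \<rho> \<le> 2 * (R ^ DIM('a) / unit_ball_vol DIM('a)) powr ((2 - r) / r) * X powr (2 / r)"
    by (rule form_le_Lr_norm[OF f r fr \<rho>i \<rho>0 \<rho>1]) (use R in simp)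
  finally have "?F \<le> D * (?IK * ?F - ?B K) + \<dots>" by simp
  moreover have "D * y = R powr (-\<gamma>) / c * (2 * y)" for y unfolding D_def by simp
  ultimately show ?thesis unfolding square_diff_form_eq[OF K(1) f] by (simp only:)
qed


section \<open>From bounded integrable functions to square integrable ones\<close>

text \<open>A normal contraction, so it does not increase the form. It maps square integrable functions to
  bounded ones that vanish where the original is at most \<open>1 / b\<close>, hence to integrable ones.\<close>

definition soft_clip :: "real \<Rightarrow> real \<Rightarrow> real" where
  "soft_clip b t = max (- b) (min b (t - max (- (1 / b)) (min (1 / b) t)))"

lemma soft_clip_measurable [measurable]: "soft_clip b \<in> borel_measurable borel"
  unfolding soft_clip_def by measurable

lemma soft_clip_le: "b > 0 \<Longrightarrow> \<bar>soft_clip b t\<bar> \<le> b"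
  and abs_soft_clip_le: "b > 0 \<Longrightarrow> \<bar>soft_clip b t\<bar> \<le> \<bar>t\<bar>"
  and soft_clip_contraction: "b > 0 \<Longrightarrow> \<bar>soft_clip b s - soft_clip b t\<bar> \<le> \<bar>s - t\<bar>"
  and soft_clip_eq_0: "b > 0 \<Longrightarrow> \<bar>t\<bar> \<le> 1 / b \<Longrightarrow> soft_clip b t = 0"
proof -
  define e where "e = 1 / b"
  have e: "b > 0 \<Longrightarrow> e > 0" by (simp add: e_def)
  show "b > 0 \<Longrightarrow> \<bar>soft_clip b t\<bar> \<le> b" "b > 0 \<Longrightarrow> \<bar>soft_clip b t\<bar> \<le> \<bar>t\<bar>"
    "b > 0 \<Longrightarrow> \<bar>soft_clip b s - soft_clip b t\<bar> \<le> \<bar>s - t\<bar>" "b > 0 \<Longrightarrow> \<bar>t\<bar> \<le> 1 / b \<Longrightarrow> soft_clip b t = 0"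
    using e unfolding soft_clip_def e_def[symmetric] by linarith+
qed

text \<open>Makes the clipping of an L^2 function integrable. Where the clipping is nonzero, |t| > 1
  / b, so |t| is at most b t^2.\<close>

lemma soft_clip_le_square:
  assumes "b > 0" shows "\<bar>soft_clip b t\<bar> \<le> b * t\<^sup>2"
proof (cases "\<bar>t\<bar> \<le> 1 / b")
  case False
  then have "1 \<le> b * \<bar>t\<bar>" using assms by (simp add: field_simps)
  then have "1 * \<bar>t\<bar> \<le> (b * \<bar>t\<bar>) * \<bar>t\<bar>" by (intro mult_right_mono) auto
  then show ?thesis using abs_soft_clip_le[OF assms, of t] by (simp add: power2_eq_square mult.assoc)
qed (use assms soft_clip_eq_0 in simp)

text \<open>The dead zone around 0 shrinks, and the level n + 1 eventually exceeds |t|.\<close>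

lemma soft_clip_tendsto: "(\<lambda>n. soft_clip (real (Suc n)) t) \<longlonglongrightarrow> t"
proof (rule Lim_transform_eventually)
  let ?e = "\<lambda>n. max (- (1 / real (Suc n))) (min (1 / real (Suc n)) t)"
  have "?e \<longlonglongrightarrow> max (- 0) (min 0 t)"
    using LIMSEQ_inverse_real_of_nat unfolding inverse_eq_divide by (intro tendsto_intros)
  moreover have "max (- 0) (min 0 t) = 0" by simp
  ultimately have e: "?e \<longlonglongrightarrow> 0" by (simp only:)
  show "(\<lambda>n. t - ?e n) \<longlonglongrightarrow> t" using tendsto_diff[OF tendsto_const e, of t] by (simp only: diff_0_right)
  obtain N where N: "\<bar>t\<bar> < real N" using reals_Archimedean2 by blast
  show "\<forall>\<^sub>F n in sequentially. t - ?e n = soft_clip (real (Suc n)) t"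
    using eventually_ge_at_top[of N]
  proof eventually_elim
    case (elim n)
    define e where "e = 1 / real (Suc n)"
    have "e > 0" by (simp add: e_def)
    moreover have "\<bar>t\<bar> \<le> real (Suc n)" using N elim by linarith
    ultimately show ?case unfolding soft_clip_def e_def[symmetric] by linarith
  qed
qed

text \<open>The bound (u - v)^2 \<le> 2 (u^2 + v^2) avoids the product f(x) f(y), which was
  integrated only for bounded f.\<close>

lemma integrable_square_diff_form:
  fixes K f :: "'a::euclidean_space \<Rightarrow> real"
  assumes K: "integrable lborel K" and [measurable]: "f \<in> borel_measurable borel" and f2: "integrable lborel (\<lambda>x. (f x)\<^sup>2)"
  shows "integrable (lborel \<Otimes>\<^sub>M lborel) (\<lambda>p. (f (fst p) - f (snd p))\<^sup>2 * K (fst p - snd p))"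
proof (rule Bochner_Integration.integrable_bound)
  have [measurable]: "K \<in> borel_measurable borel" using K by auto
  show "integrable (lborel \<Otimes>\<^sub>M lborel) (\<lambda>p. 2 * (K (fst p - snd p) * (f (fst p))\<^sup>2 + K (fst p - snd p) * (f (snd p))\<^sup>2))"
    using integrable_lborel_conv_fst[OF K f2] integrable_lborel_conv[OF K f2, of 1] by simp
  show "(\<lambda>p. (f (fst p) - f (snd p))\<^sup>2 * K (fst p - snd p)) \<in> borel_measurable (lborel \<Otimes>\<^sub>M lborel)" by measurable
  show "AE p in lborel \<Otimes>\<^sub>M lborel. norm ((f (fst p) - f (snd p))\<^sup>2 * K (fst p - snd p))
     \<le> norm (2 * (K (fst p - snd p) * (f (fst p))\<^sup>2 + K (fst p - snd p) * (f (snd p))\<^sup>2))"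
  proof (rule AE_I2)
    fix p :: "'a \<times> 'a"
    have le: "(u - v)\<^sup>2 \<le> 2 * (u\<^sup>2 + v\<^sup>2)" for u v :: real
      using zero_le_power2[of "u + v"] by (simp add: power2_eq_square algebra_simps)
    have "(f (fst p) - f (snd p))\<^sup>2 * \<bar>K (fst p - snd p)\<bar> \<le> (2 * ((f (fst p))\<^sup>2 + (f (snd p))\<^sup>2)) * \<bar>K (fst p - snd p)\<bar>"
      by (intro mult_right_mono le) auto
    also have "\<dots> = norm (2 * (K (fst p - snd p) * (f (fst p))\<^sup>2 + K (fst p - snd p) * (f (snd p))\<^sup>2))"
      unfolding distrib_left[symmetric] by (simp add: abs_mult)
    finally show "norm ((f (fst p) - f (snd p))\<^sup>2 * K (fst p - snd p))
     \<le> norm (2 * (K (fst p - snd p) * (f (fst p))\<^sup>2 + K (fst p - snd p) * (f (snd p))\<^sup>2))" by (simp add: abs_mult)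
  qed
qed

text \<open>Clipping lowers the form, since it is a contraction and K is nonnegative, and also the
  L^r norm. The right side is therefore uniform in n, while the left side converges by dominated
  convergence.\<close>

proposition Nash_inequality:
  fixes K f :: "'a::euclidean_space \<Rightarrow> real"
  assumes K: "integrable lborel K" "\<And>z. 0 \<le> K z" and c: "0 < c" and \<gamma>: "0 < \<gamma>" "\<gamma> \<le> 2"
    and low: "\<And>\<xi>. norm \<xi> \<le> 1 \<Longrightarrow> c * norm \<xi> powr \<gamma> \<le> (LINT z|lborel. (1 - cos (z \<bullet> \<xi>)) * K z)"
    and high: "\<And>\<xi>. 1 \<le> norm \<xi> \<Longrightarrow> c \<le> (LINT z|lborel. (1 - cos (z \<bullet> \<xi>)) * K z)"
    and f [measurable]: "f \<in> borel_measurable borel" and f2: "integrable lborel (\<lambda>x. (f x)\<^sup>2)" and r: "1 < r" "r < 2"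
    and fr: "integrable lborel (\<lambda>x. \<bar>f x\<bar> powr r)" "0 < (LINT x|lborel. \<bar>f x\<bar> powr r)"
    and R: "0 < R" "R \<le> 1"
  shows "(LINT x|lborel. (f x)\<^sup>2) \<le> R powr (-\<gamma>) / c * (LINT p|(lborel \<Otimes>\<^sub>M lborel). (f (fst p) - f (snd p))\<^sup>2 * K (fst p - snd p))
     + 2 * (R ^ DIM('a) / unit_ball_vol DIM('a)) powr ((2 - r) / r) * (LINT x|lborel. \<bar>f x\<bar> powr r) powr (2 / r)"
    (is "_ \<le> _ * ?E f + ?rest")
proof -
  let ?f = "\<lambda>n x. soft_clip (real (Suc n)) (f x)"
  have f2n: "integrable lborel (\<lambda>x. (?f n x)\<^sup>2)" for n
  proof (rule Bochner_Integration.integrable_bound[OF f2])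
    show "AE x in lborel. norm ((?f n x)\<^sup>2) \<le> norm ((f x)\<^sup>2)"
      using abs_soft_clip_le[of "real (Suc n)"] by (intro AE_I2) (simp add: abs_le_square_iff)
  qed measurable
  have lim: "(\<lambda>n. LINT x|lborel. (?f n x)\<^sup>2) \<longlonglongrightarrow> (LINT x|lborel. (f x)\<^sup>2)"
  proof (rule integral_dominated_convergence[OF _ _ f2])
    show "AE x in lborel. (\<lambda>n. (?f n x)\<^sup>2) \<longlonglongrightarrow> (f x)\<^sup>2" by (intro AE_I2 tendsto_intros soft_clip_tendsto)
    show "AE x in lborel. norm ((?f n x)\<^sup>2) \<le> (f x)\<^sup>2" for n
      using abs_soft_clip_le[of "real (Suc n)"] by (intro AE_I2) (simp add: abs_le_square_iff)
  qed measurable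
  have "(LINT x|lborel. (?f n x)\<^sup>2) \<le> R powr (-\<gamma>) / c * ?E f + ?rest" for n
  proof -
    have le: "\<bar>?f n x\<bar> powr r \<le> \<bar>f x\<bar> powr r" for x
      using abs_soft_clip_le[of "real (Suc n)" "f x"] r by (intro powr_mono2) auto
    have ir: "integrable lborel (\<lambda>x. \<bar>?f n x\<bar> powr r)"
      by (rule Bochner_Integration.integrable_bound[OF fr(1)]) (use le in auto)
    have 1: "(LINT x|lborel. (?f n x)\<^sup>2) \<le> R powr (-\<gamma>) / c * ?E (?f n) + ?rest"
    proof (rule Nash_inequality_bounded[OF K c \<gamma> low high _ _ r ir _ fr(2) R])
      show "integrable lborel (?f n)"
      proof (rule Bochner_Integration.integrable_bound)
        show "integrable lborel (\<lambda>x. real (Suc n) * (f x)\<^sup>2)" using f2 by (rule integrable_mult_right)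
        show "AE x in lborel. norm (?f n x) \<le> norm (real (Suc n) * (f x)\<^sup>2)"
          using soft_clip_le_square[of "real (Suc n)"] by (intro AE_I2) (simp add: abs_mult)
      qed measurable
      show "(LINT x|lborel. \<bar>?f n x\<bar> powr r) \<le> (LINT x|lborel. \<bar>f x\<bar> powr r)"
        by (rule integral_mono[OF ir fr(1) le])
    qed (auto intro: soft_clip_le)
    have 2: "?E (?f n) \<le> ?E f"
    proof (rule integral_mono[OF integrable_square_diff_form[OF K(1) _ f2n] integrable_square_diff_form[OF K(1) f f2]])
      show "(?f n (fst p) - ?f n (snd p))\<^sup>2 * K (fst p - snd p) \<le> (f (fst p) - f (snd p))\<^sup>2 * K (fst p - snd p)" for p
        using soft_clip_contraction[of "real (Suc n)" "f (fst p)" "f (snd p)"] K(2)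
        by (intro mult_right_mono) (auto simp: abs_le_square_iff)
    qed measurable
    show ?thesis
      by (rule order_trans[OF 1 add_right_mono[OF mult_left_mono[OF 2]]]) (use c in simp)
  qed
  then show ?thesis by (intro LIMSEQ_le_const2[OF lim]) blast
qed


section \<open>Truncation of the kernel and interpolation\<close>

text \<open>The part of H within radius e contributes at most |\<xi>|^2 / 2 times its second moment,
  which tends to 0 with e. Once that moment is below c, the loss for |\<xi>| \<le> 1 is at most half
  of the lower bound.\<close>

lemma truncated_kernel:
  fixes H :: "'a::euclidean_space \<Rightarrow> real"
  assumes [measurable]: "H \<in> borel_measurable borel" and H0: "\<And>z. 0 \<le> H z"
    and Hi: "integrable lborel (\<lambda>z. H z * min ((norm z)\<^sup>2) 1)"
    and \<delta>: "0 < \<delta>" "AE z in lborel. 0 < norm z \<and> norm z < \<delta> \<longrightarrow> 0 < H z"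
    and \<gamma>: "\<gamma> \<le> 2" and c: "0 < c"
    and low: "\<And>\<xi>. norm \<xi> \<le> 1 \<Longrightarrow> c * norm \<xi> powr \<gamma> \<le> (LINT z|lborel. (1 - cos (z \<bullet> \<xi>)) * H z)"
  shows "\<exists>K b. integrable lborel K \<and> (\<forall>z. 0 \<le> K z \<and> K z \<le> H z) \<and> 0 < b \<and>
    (\<forall>\<xi>. norm \<xi> \<le> 1 \<longrightarrow> b * norm \<xi> powr \<gamma> \<le> (LINT z|lborel. (1 - cos (z \<bullet> \<xi>)) * K z)) \<and>
    (\<forall>\<xi>. 1 \<le> norm \<xi> \<longrightarrow> b \<le> (LINT z|lborel. (1 - cos (z \<bullet> \<xi>)) * K z))"
proof -
  define I where "I e z = (if norm z \<le> e then H z else 0)" for e and z :: 'a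
  have [measurable]: "I e \<in> borel_measurable borel" for e unfolding I_def by measurable
  have "(\<lambda>n. LINT z|lborel. (norm z)\<^sup>2 * I (inverse (real (Suc n))) z) \<longlonglongrightarrow> integral\<^sup>L lborel (\<lambda>z::'a. 0::real)"
  proof (rule integral_dominated_convergence[OF _ _ Hi])
    show "AE z in lborel. (\<lambda>n. (norm z)\<^sup>2 * I (inverse (real (Suc n))) z) \<longlonglongrightarrow> 0"
    proof (rule AE_I2)
      fix z :: 'a
      show "(\<lambda>n. (norm z)\<^sup>2 * I (inverse (real (Suc n))) z) \<longlonglongrightarrow> 0"
      proof (cases "z = 0")
        case False
        then have "\<forall>\<^sub>F n in sequentially. inverse (real (Suc n)) < norm z"
          using order_tendstoD(2)[OF LIMSEQ_inverse_real_of_nat, of "norm z"] by simp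
        then have "\<forall>\<^sub>F n in sequentially. (norm z)\<^sup>2 * I (inverse (real (Suc n))) z = 0"
          by eventually_elim (simp add: I_def)
        then show ?thesis by (rule tendsto_eventually)
      qed simp
    qed
    show "AE z in lborel. norm ((norm z)\<^sup>2 * I (inverse (real (Suc n))) z) \<le> H z * min ((norm z)\<^sup>2) 1" for n
    proof (rule AE_I2)
      fix z :: 'a
      have "(norm z)\<^sup>2 \<le> 1" if "norm z \<le> inverse (real (Suc n))"
        using that by (intro power_le_one) (auto intro: order_trans[OF _ inverse_le_1_iff[THEN iffD2]])
      then show "norm ((norm z)\<^sup>2 * I (inverse (real (Suc n))) z) \<le> H z * min ((norm z)\<^sup>2) 1"
        using H0[of z] by (auto simp: I_def min_def abs_mult mult.commute)
    qed
  qed measurable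
  then have "(\<lambda>n. LINT z|lborel. (norm z)\<^sup>2 * I (inverse (real (Suc n))) z) \<longlonglongrightarrow> 0" by simp
  from order_tendstoD(2)[OF this c] order_tendstoD(2)[OF LIMSEQ_inverse_real_of_nat \<delta>(1)]
  have "\<forall>\<^sub>F n in sequentially. (LINT z|lborel. (norm z)\<^sup>2 * I (inverse (real (Suc n))) z) < c \<and> inverse (real (Suc n)) < \<delta>"
    by (rule eventually_conj)
  then obtain n where n: "(LINT z|lborel. (norm z)\<^sup>2 * I (inverse (real (Suc n))) z) < c" "inverse (real (Suc n)) < \<delta>"
    using eventually_happens'[OF sequentially_bot] by blast
  define e where "e = inverse (real (Suc n))"
  have e: "0 < e" "e < \<delta>" "e \<le> 1" "(LINT z|lborel. (norm z)\<^sup>2 * I e z) < c" using n by (auto simp: e_def field_simps)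
  define K where "K z = (if norm z \<le> e then 0 else H z)" for z
  have [measurable]: "K \<in> borel_measurable borel" unfolding K_def by measurable
  have K0: "0 \<le> K z" and KH: "K z \<le> H z" for z unfolding K_def using H0[of z] by auto
  \<comment> \<open>Outside the ball of radius e \<le> 1 the weight min(|z|^2, 1) is at least
    e^2.\<close>
  have Ki: "integrable lborel K"
  proof (rule Bochner_Integration.integrable_bound)
    show "integrable lborel (\<lambda>z. (1 / e\<^sup>2) * (H z * min ((norm z)\<^sup>2) 1))" using Hi by (rule integrable_mult_right)
    show "AE z in lborel. norm (K z) \<le> norm ((1 / e\<^sup>2) * (H z * min ((norm z)\<^sup>2) 1))"
    proof (rule AE_I2)
      fix z :: 'a
      have "H z * e\<^sup>2 \<le> H z * min ((norm z)\<^sup>2) 1" if "e < norm z"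
        using that e H0 by (intro mult_left_mono) (auto intro: power_mono power_le_one)
      then show "norm (K z) \<le> norm ((1 / e\<^sup>2) * (H z * min ((norm z)\<^sup>2) 1))"
        unfolding K_def using e H0[of z] by (auto simp: field_simps)
    qed
  qed measurable
  have cosb: "0 \<le> 1 - cos t" "1 - cos t \<le> 2" for t :: real using cos_ge_minus_one[of t] by auto
  have Hci: "integrable lborel (\<lambda>z. (1 - cos (z \<bullet> \<xi>)) * H z)" and lowI: "(LINT z|lborel. (1 - cos (z \<bullet> \<xi>)) * I e z) \<le> (norm \<xi>)\<^sup>2 / 2 * c" for \<xi>
  proof -
    have le: "1 - cos (z \<bullet> \<xi>) \<le> (norm \<xi>)\<^sup>2 / 2 * (norm z)\<^sup>2" for z
    proof -
      have "(z \<bullet> \<xi>)\<^sup>2 \<le> (norm z * norm \<xi>)\<^sup>2"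
        using power_mono[OF Cauchy_Schwarz_ineq2[of z \<xi>], of 2] by simp
      then show ?thesis using one_minus_cos_le[of "z \<bullet> \<xi>"] by (simp add: power_mult_distrib mult.commute)
    qed
    show "integrable lborel (\<lambda>z. (1 - cos (z \<bullet> \<xi>)) * H z)"
    proof (rule Bochner_Integration.integrable_bound)
      show "integrable lborel (\<lambda>z. ((norm \<xi>)\<^sup>2 / 2 + 2) * (H z * min ((norm z)\<^sup>2) 1))" using Hi by (rule integrable_mult_right)
      show "AE z in lborel. norm ((1 - cos (z \<bullet> \<xi>)) * H z) \<le> norm (((norm \<xi>)\<^sup>2 / 2 + 2) * (H z * min ((norm z)\<^sup>2) 1))"
      proof (rule AE_I2)
        fix z :: 'a
        have "1 - cos (z \<bullet> \<xi>) \<le> ((norm \<xi>)\<^sup>2 / 2 + 2) * min ((norm z)\<^sup>2) 1"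
        proof (cases "(norm z)\<^sup>2 \<le> 1")
          case True
          have "(norm \<xi>)\<^sup>2 / 2 * (norm z)\<^sup>2 \<le> ((norm \<xi>)\<^sup>2 / 2 + 2) * (norm z)\<^sup>2" by (intro mult_right_mono) auto
          then show ?thesis using le[of z] True by (simp only: min_absorb1)
        next
          case False
          have "2 \<le> (norm \<xi>)\<^sup>2 / 2 + 2" by simp
          then have "1 - cos (z \<bullet> \<xi>) \<le> (norm \<xi>)\<^sup>2 / 2 + 2" using cosb(2)[of "z \<bullet> \<xi>"] by linarith
          then show ?thesis using False by (simp add: min_absorb2)
        qed
        then have "(1 - cos (z \<bullet> \<xi>)) * H z \<le> ((norm \<xi>)\<^sup>2 / 2 + 2) * min ((norm z)\<^sup>2) 1 * H z"
          using H0 by (rule mult_right_mono)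
        then show "norm ((1 - cos (z \<bullet> \<xi>)) * H z) \<le> norm (((norm \<xi>)\<^sup>2 / 2 + 2) * (H z * min ((norm z)\<^sup>2) 1))"
          using cosb(1)[of "z \<bullet> \<xi>"] H0[of z] by (simp add: abs_mult mult_ac)
      qed
    qed measurable
    have Ini: "integrable lborel (\<lambda>z. (norm z)\<^sup>2 * I e z)"
    proof (rule Bochner_Integration.integrable_bound[OF Hi])
      show "AE z in lborel. norm ((norm z)\<^sup>2 * I e z) \<le> norm (H z * min ((norm z)\<^sup>2) 1)"
      proof (rule AE_I2)
        fix z :: 'a
        have "(norm z)\<^sup>2 \<le> 1" if "norm z \<le> e" using that e by (intro power_le_one) auto
        then show "norm ((norm z)\<^sup>2 * I e z) \<le> norm (H z * min ((norm z)\<^sup>2) 1)"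
          using H0[of z] by (auto simp: I_def min_def abs_mult mult.commute)
      qed
    qed measurable
    have I0: "0 \<le> I e z" for z using H0[of z] by (simp add: I_def)
    have "(LINT z|lborel. (1 - cos (z \<bullet> \<xi>)) * I e z) \<le> (LINT z|lborel. (norm \<xi>)\<^sup>2 / 2 * ((norm z)\<^sup>2 * I e z))"
    proof (rule integral_mono')
      show "(1 - cos (z \<bullet> \<xi>)) * I e z \<le> (norm \<xi>)\<^sup>2 / 2 * ((norm z)\<^sup>2 * I e z)" for z
        using mult_right_mono[OF le[of z] I0[of z]] by (simp add: mult.assoc)
      show "0 \<le> (norm \<xi>)\<^sup>2 / 2 * ((norm z)\<^sup>2 * I e z)" for z using I0[of z] by simp
    qed (use Ini in \<open>rule integrable_mult_right\<close>)
    also have "\<dots> = (norm \<xi>)\<^sup>2 / 2 * (LINT z|lborel. (norm z)\<^sup>2 * I e z)" by simp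
    also have "\<dots> \<le> (norm \<xi>)\<^sup>2 / 2 * c" using e(4) by (intro mult_left_mono) auto
    finally show "(LINT z|lborel. (1 - cos (z \<bullet> \<xi>)) * I e z) \<le> (norm \<xi>)\<^sup>2 / 2 * c" .
  qed
  have lowK: "c / 2 * norm \<xi> powr \<gamma> \<le> (LINT z|lborel. (1 - cos (z \<bullet> \<xi>)) * K z)" if \<xi>: "norm \<xi> \<le> 1" for \<xi>
  proof -
    have Ii: "integrable lborel (\<lambda>z. (1 - cos (z \<bullet> \<xi>)) * I e z)" and Kci: "integrable lborel (\<lambda>z. (1 - cos (z \<bullet> \<xi>)) * K z)"
      using H0 by (auto intro!: Bochner_Integration.integrable_bound[OF Hci[of \<xi>]] simp: I_def K_def)
    have "(LINT z|lborel. (1 - cos (z \<bullet> \<xi>)) * H z) = (LINT z|lborel. (1 - cos (z \<bullet> \<xi>)) * I e z + (1 - cos (z \<bullet> \<xi>)) * K z)"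
      by (intro Bochner_Integration.integral_cong) (auto simp: I_def K_def)
    also have "\<dots> = (LINT z|lborel. (1 - cos (z \<bullet> \<xi>)) * I e z) + (LINT z|lborel. (1 - cos (z \<bullet> \<xi>)) * K z)"
      using Ii Kci by simp
    finally have "c * norm \<xi> powr \<gamma> \<le> (norm \<xi>)\<^sup>2 / 2 * c + (LINT z|lborel. (1 - cos (z \<bullet> \<xi>)) * K z)"
      using low[OF \<xi>] lowI[of \<xi>] by linarith
    moreover have "(norm \<xi>)\<^sup>2 \<le> norm \<xi> powr \<gamma>"
    proof (cases "\<xi> = 0")
      case False
      then have "(norm \<xi>)\<^sup>2 = norm \<xi> powr 2" by simp
      also have "\<dots> \<le> norm \<xi> powr \<gamma>" using \<xi> \<gamma> by (intro powr_mono') auto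
      finally show ?thesis .
    qed simp
    then have "(norm \<xi>)\<^sup>2 / 2 * c \<le> norm \<xi> powr \<gamma> / 2 * c" using c by (intro mult_right_mono) auto
    ultimately show ?thesis by (simp add: algebra_simps)
  qed
  \<comment> \<open>The shell between the cut-off radius and \<delta> is where K is still positive,
    as \<open>symbol_bounded_below\<close> demands; e < \<delta> was arranged for this.\<close>
  define U where "U = {z::'a. e < norm z \<and> norm z < \<delta>}"
  have "open U" unfolding U_def by (intro open_Collect_conj open_Collect_less continuous_intros)
  moreover have "U \<noteq> {}"
  proof -
    obtain b :: 'a where b: "b \<in> Basis" using nonempty_Basis by blast
    have "((e + \<delta>) / 2) *\<^sub>R b \<in> U" unfolding U_def using b e by simp
    then show ?thesis by blast
  qed
  moreover have "AE z in lborel. z \<in> U \<longrightarrow> 0 < K z"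
    using \<delta>(2) by eventually_elim (use e in \<open>auto simp: U_def K_def\<close>)
  ultimately obtain b where b: "b > 0" "\<And>\<xi>. 1 \<le> norm \<xi> \<Longrightarrow> b \<le> (LINT z|lborel. (1 - cos (z \<bullet> \<xi>)) * K z)"
    using symbol_bounded_below[OF Ki K0] by blast
  have "min (c / 2) b * norm \<xi> powr \<gamma> \<le> (LINT z|lborel. (1 - cos (z \<bullet> \<xi>)) * K z)" if "norm \<xi> \<le> 1" for \<xi>
    by (rule order_trans[OF mult_right_mono lowK[OF that]]) auto
  moreover have "min (c / 2) b \<le> (LINT z|lborel. (1 - cos (z \<bullet> \<xi>)) * K z)" if "1 \<le> norm \<xi>" for \<xi>
    using b(2)[OF that] by simp
  ultimately show ?thesis
    using b(1) c Ki K0 KH by (intro exI[of _ K] exI[of _ "min (c / 2) b"]) auto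
qed

text \<open>Young's inequality with weights \<open>?a\<close> and \<open>?b\<close>, for which s =
  \<open>?a\<close> r + \<open>?b\<close> q, is applied to the r-th and q-th powers normalised to
  have integral 1. The resulting bound then integrates to \<open>?a + ?b = 1\<close>.\<close>

lemma Lp_interpolation:
  fixes f :: "'a \<Rightarrow> real"
  assumes [measurable]: "f \<in> borel_measurable M" and r: "r < s" "s \<le> q"
    and fr: "integrable M (\<lambda>x. \<bar>f x\<bar> powr r)" "0 < (LINT x|M. \<bar>f x\<bar> powr r)"
    and fq: "integrable M (\<lambda>x. \<bar>f x\<bar> powr q)" "0 < (LINT x|M. \<bar>f x\<bar> powr q)"
  shows "(LINT x|M. \<bar>f x\<bar> powr s) \<le> (LINT x|M. \<bar>f x\<bar> powr r) powr ((q - s) / (q - r)) * (LINT x|M. \<bar>f x\<bar> powr q) powr ((s - r) / (q - r))"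
    (is "_ \<le> ?X powr ?a * ?A powr ?b")
proof -
  have ab: "0 \<le> ?a" "0 \<le> ?b" "?a + ?b = 1" using r by (auto simp: add_divide_distrib[symmetric])
  have i: "integrable M (\<lambda>x. (?X powr ?a * ?A powr ?b) * (?a * (\<bar>f x\<bar> powr r / ?X) + ?b * (\<bar>f x\<bar> powr q / ?A)))"
    by (intro integrable_mult_right Bochner_Integration.integrable_add integrable_divide_zero fr(1) fq(1))
  have le: "\<bar>f x\<bar> powr s \<le> (?X powr ?a * ?A powr ?b) * (?a * (\<bar>f x\<bar> powr r / ?X) + ?b * (\<bar>f x\<bar> powr q / ?A))" for x
  proof (cases "f x = 0")
    case False
    have "(\<bar>f x\<bar> powr r / ?X) powr ?a * (\<bar>f x\<bar> powr q / ?A) powr ?b \<le> ?a * (\<bar>f x\<bar> powr r / ?X) + ?b * (\<bar>f x\<bar> powr q / ?A)"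
      using ab fr fq False by (intro Youngs_inequality_0) auto
    then have "(?X powr ?a * ?A powr ?b) * ((\<bar>f x\<bar> powr r / ?X) powr ?a * (\<bar>f x\<bar> powr q / ?A) powr ?b) \<le> (?X powr ?a * ?A powr ?b) * (?a * (\<bar>f x\<bar> powr r / ?X) + ?b * (\<bar>f x\<bar> powr q / ?A))"
      by (intro mult_left_mono) auto
    moreover have "(?X powr ?a * ?A powr ?b) * ((\<bar>f x\<bar> powr r / ?X) powr ?a * (\<bar>f x\<bar> powr q / ?A) powr ?b) = \<bar>f x\<bar> powr (r * ?a + q * ?b)"
      using fr fq by (simp add: powr_divide powr_powr powr_add)
    moreover have "r * ?a + q * ?b = s"
    proof -
      have "r * ?a + q * ?b = (r * (q - s) + q * (s - r)) / (q - r)" by (simp only: times_divide_eq_right add_divide_distrib)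
      also have "r * (q - s) + q * (s - r) = s * (q - r)" by (simp add: algebra_simps)
      finally show ?thesis using r by simp
    qed
    ultimately show ?thesis by simp
  qed (use ab in simp)
  have "(LINT x|M. \<bar>f x\<bar> powr s) \<le> (LINT x|M. (?X powr ?a * ?A powr ?b) * (?a * (\<bar>f x\<bar> powr r / ?X) + ?b * (\<bar>f x\<bar> powr q / ?A)))"
    by (intro integral_mono' i le order_trans[OF _ le]) auto
  also have "\<dots> = (?X powr ?a * ?A powr ?b) * (?a * (?X / ?X) + ?b * (?A / ?A))"
    using fr(1) fq(1) by simp
  also have "?a * (?X / ?X) + ?b * (?A / ?A) = 1" using fr fq ab(3) by simp
  finally show ?thesis by simp
qed

text \<open>A stands for the squared L^2 norm, W for the squared L^r norm and E for the form. The
  two arguments of the minimum come from R = 1 and from the unconstrained choice of R.\<close>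

lemma optimise_scale:
  fixes A W E C\<^sub>1 C\<^sub>2 \<gamma> n :: real
  assumes "0 < A" "0 < W" "0 < C\<^sub>1" "0 < C\<^sub>2" "0 < \<gamma>" "0 < n"
    and le: "\<And>R. 0 < R \<Longrightarrow> R \<le> 1 \<Longrightarrow> A \<le> R powr (-\<gamma>) * C\<^sub>1 * E + C\<^sub>2 * R powr n * W"
  shows "min 1 ((2 * C\<^sub>2) powr (- (\<gamma> / n))) / (2 * C\<^sub>1) * min A (A * (A / W) powr (\<gamma> / n)) \<le> E"
proof -
  \<comment> \<open>Solves \<open>C\<^sub>2 * R powr n * W = A / 2\<close>.\<close>
  define R\<^sub>0 where "R\<^sub>0 = (A / W / (2 * C\<^sub>2)) powr (1 / n)"
  define R where "R = min 1 R\<^sub>0"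
  let ?m = "min 1 ((2 * C\<^sub>2) powr (- (\<gamma> / n)))"
  have R0: "R\<^sub>0 > 0" unfolding R\<^sub>0_def using assms by simp
  then have R: "0 < R" "R \<le> 1" unfolding R_def by auto
  have "R powr n \<le> R\<^sub>0 powr n" using R assms by (intro powr_mono2) (auto simp: R_def)
  also have "\<dots> = A / W / (2 * C\<^sub>2)" unfolding R\<^sub>0_def using assms by (simp add: powr_powr)
  finally have "C\<^sub>2 * R powr n * W \<le> C\<^sub>2 * (A / W / (2 * C\<^sub>2)) * W"
    using assms by (intro mult_right_mono mult_left_mono) auto
  also have "\<dots> = A / 2" using assms by simp
  finally have "A / 2 \<le> R powr (-\<gamma>) * C\<^sub>1 * E" using le[OF R] by linarith
  then have "R powr \<gamma> * (A / 2) \<le> R powr \<gamma> * (R powr (-\<gamma>) * C\<^sub>1 * E)" by (intro mult_left_mono) auto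
  also have "\<dots> = C\<^sub>1 * E" using R by (simp add: powr_minus_divide)
  finally have E: "R powr \<gamma> * A / (2 * C\<^sub>1) \<le> E" using assms by (simp add: field_simps)
  have "?m * min A (A * (A / W) powr (\<gamma> / n)) \<le> R powr \<gamma> * A"
  proof (cases "1 \<le> R\<^sub>0")
    case True
    then have "R = 1" by (simp add: R_def)
    moreover have "?m * min A (A * (A / W) powr (\<gamma> / n)) \<le> 1 * A" using assms by (intro mult_mono) auto
    ultimately show ?thesis by simp
  next
    case False
    then have "R = R\<^sub>0" by (simp add: R_def)
    then have "R powr \<gamma> * A = (2 * C\<^sub>2) powr (- (\<gamma> / n)) * (A * (A / W) powr (\<gamma> / n))"
      unfolding R\<^sub>0_def using assms(1-6)
      by (simp add: powr_powr powr_divide powr_minus_divide powr_mult) (simp add: mult_ac)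
    also have "\<dots> \<ge> ?m * min A (A * (A / W) powr (\<gamma> / n))" using assms by (intro mult_mono) auto
    finally show ?thesis .
  qed
  then have "?m * min A (A * (A / W) powr (\<gamma> / n)) / (2 * C\<^sub>1) \<le> R powr \<gamma> * A / (2 * C\<^sub>1)"
    using assms by (intro divide_right_mono) auto
  with E show ?thesis by simp
qed


section \<open>Passage from the completed measure to Borel representatives\<close>

lemma
  fixes f g :: "'a::euclidean_space \<Rightarrow> real"
  assumes f: "f \<in> borel_measurable lebesgue" and g: "g \<in> borel_measurable borel" and eq: "AE x in lborel. f x = g x"
  shows lebesgue_integral_eq_lborel: "(LINT x|lebesgue. f x) = (LINT x|lborel. g x)"
    and lebesgue_integrable_eq_lborel: "integrable lebesgue f \<longleftrightarrow> integrable lborel g"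
proof -
  have g': "g \<in> borel_measurable lborel" using g by simp
  have gl: "g \<in> borel_measurable lebesgue" using g' by (rule measurable_completion)
  have "(LINT x|lebesgue. f x) = (LINT x|lebesgue. g x)"
    using f gl AE_completion[OF eq] by (rule integral_cong_AE)
  then show "(LINT x|lebesgue. f x) = (LINT x|lborel. g x)" using integral_completion[OF g'] by simp
  have "integrable lebesgue f \<longleftrightarrow> integrable lebesgue g"
    using f gl AE_completion[OF eq] by (rule integrable_cong_AE)
  then show "integrable lebesgue f \<longleftrightarrow> integrable lborel g" using integrable_completion[OF g'] by simp
qed

text \<open>The form of J is an iterated integral over the completed measure, that of K an integral
  over the Borel product. They are compared fibre by fibre: the null sets for z(x), for z(y) and for
  the kernel at x - y are discarded in the outer or inner integral where each occurs.\<close>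

lemma dirichlet_form_ge:
  fixes J K f z :: "'a::euclidean_space \<Rightarrow> real"
  assumes K: "integrable lborel K" "\<And>z. 0 \<le> K z" and KJ: "AE z in lborel. K z \<le> J z"
    and f [measurable]: "f \<in> borel_measurable borel" and f2: "integrable lborel (\<lambda>x. (f x)\<^sup>2)" and zf: "AE x in lborel. z x = f x"
  shows "ennreal ((LINT p|(lborel \<Otimes>\<^sub>M lborel). (f (fst p) - f (snd p))\<^sup>2 * K (fst p - snd p)) / 2) \<le> dirichlet_form J z"
proof -
  have [measurable]: "K \<in> borel_measurable borel" using K by auto
  let ?E = "LINT p|(lborel \<Otimes>\<^sub>M lborel). (f (fst p) - f (snd p))\<^sup>2 * K (fst p - snd p)"
  have E0: "0 \<le> ?E" using K(2) by simp
  have "ennreal ?E = (\<integral>\<^sup>+p. ennreal ((f (fst p) - f (snd p))\<^sup>2 * K (fst p - snd p)) \<partial>(lborel \<Otimes>\<^sub>M lborel))"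
    using nn_integral_eq_integral[OF integrable_square_diff_form[OF K(1) f f2]] K(2) by simp
  also have "\<dots> = (\<integral>\<^sup>+x. \<integral>\<^sup>+y. ennreal ((f x - f y)\<^sup>2 * K (x - y)) \<partial>lborel \<partial>lborel)"
    by (subst lborel.nn_integral_fst[symmetric]) simp_all
  also have "\<dots> \<le> (\<integral>\<^sup>+x. \<integral>\<^sup>+y. ennreal ((z x - z y)\<^sup>2 * J (x - y)) \<partial>lborel \<partial>lborel)"
  proof (rule nn_integral_mono_AE)
    show "AE x in lborel. (\<integral>\<^sup>+y. ennreal ((f x - f y)\<^sup>2 * K (x - y)) \<partial>lborel) \<le> (\<integral>\<^sup>+y. ennreal ((z x - z y)\<^sup>2 * J (x - y)) \<partial>lborel)"
      using zf
    proof eventually_elim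
      case (elim x)
      show ?case
      proof (rule nn_integral_mono_AE)
        show "AE y in lborel. ennreal ((f x - f y)\<^sup>2 * K (x - y)) \<le> ennreal ((z x - z y)\<^sup>2 * J (x - y))"
          using zf AE_lborel_reflect[OF KJ, of x] by eventually_elim (simp add: elim ennreal_leI mult_left_mono)
      qed
    qed
  qed
  also have "\<dots> = (\<integral>\<^sup>+x. (\<integral>\<^sup>+y. ennreal ((z x - z y)\<^sup>2 * J (x - y)) \<partial>lebesgue) \<partial>lebesgue)"
    by (simp add: nn_integral_completion)
  finally have "(1/2) * ennreal ?E \<le> dirichlet_form J z" unfolding dirichlet_form_def by (rule mult_left_mono) simp
  moreover have "ennreal (?E / 2) = (1/2) * ennreal ?E"
    using ennreal_divide_numeral[OF E0, of "num.Bit0 num.One"] by (simp add: ennreal_times_divide divide_ennreal_def mult.commute)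
  ultimately show ?thesis by simp
qed

text \<open>X, A and Y are the integrals of the powers r, 2 and s of |f|. Interpolation bounds the
  quotient in the theorem by a monomial in X and A; \<theta> < 1 makes the outer power monotone. The
  next two lemmas evaluate the exponents.\<close>

lemma norm_ratio_le:
  fixes X A Y r s \<theta> :: real
  assumes "0 < X" "0 < A" "0 \<le> Y" "Y \<le> X powr ((2 - s) / (2 - r)) * A powr ((s - r) / (2 - r))" "1 < r" "r < s" "\<theta> < 1"
  shows "(Y powr (1 / s) * (X powr (1 / r)) powr (- \<theta>)) powr (2 / (1 - \<theta>))
    \<le> X powr (((2 - s) / ((2 - r) * s) - \<theta> / r) * (2 / (1 - \<theta>))) * A powr ((s - r) / ((2 - r) * s) * (2 / (1 - \<theta>)))"
proof -
  have "Y powr (1 / s) \<le> (X powr ((2 - s) / (2 - r)) * A powr ((s - r) / (2 - r))) powr (1 / s)"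
    using assms by (intro powr_mono2) auto
  also have "\<dots> = X powr ((2 - s) / ((2 - r) * s)) * A powr ((s - r) / ((2 - r) * s))"
    using assms by (simp add: powr_mult powr_powr)
  finally have "Y powr (1 / s) * (X powr (1 / r)) powr (- \<theta>) \<le> X powr ((2 - s) / ((2 - r) * s)) * A powr ((s - r) / ((2 - r) * s)) * (X powr (1 / r)) powr (- \<theta>)"
    by (rule mult_right_mono) simp
  also have "\<dots> = X powr ((2 - s) / ((2 - r) * s) - \<theta> / r) * A powr ((s - r) / ((2 - r) * s))"
    using assms by (simp add: powr_powr powr_diff powr_minus_divide)
  finally have "(Y powr (1 / s) * (X powr (1 / r)) powr (- \<theta>)) powr (2 / (1 - \<theta>))
     \<le> (X powr ((2 - s) / ((2 - r) * s) - \<theta> / r) * A powr ((s - r) / ((2 - r) * s))) powr (2 / (1 - \<theta>))"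
    using assms by (intro powr_mono2) auto
  also have "\<dots> = X powr (((2 - s) / ((2 - r) * s) - \<theta> / r) * (2 / (1 - \<theta>))) * A powr ((s - r) / ((2 - r) * s) * (2 / (1 - \<theta>)))"
    using assms by (simp add: powr_mult powr_powr)
  finally show ?thesis .
qed

text \<open>With n = N (2 - r) / r these are the exponents of X and A in
  \<open>A * (A / X powr (2 / r)) powr (\<gamma> / n)\<close>, the value produced by
  \<open>optimise_scale\<close>. All follow from 1 - \<theta> = 2 N (s - r) / (s D).\<close>

lemma exponent_low_frequency:
  fixes N r s \<gamma> :: real
  defines "\<theta> \<equiv> (r * (N * (2 - s) + \<gamma> * s)) / (s * (N * (2 - r) + \<gamma> * r))"
  assumes "0 < N" "0 < \<gamma>" "1 < r" "r < s" "s \<le> 2"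
  shows "\<theta> < 1"
    and "((2 - s) / ((2 - r) * s) - \<theta> / r) * (2 / (1 - \<theta>)) = - (2 / r * (\<gamma> / (N * ((2 - r) / r))))"
    and "(s - r) / ((2 - r) * s) * (2 / (1 - \<theta>)) = 1 + \<gamma> / (N * ((2 - r) / r))"
proof -
  define D where "D = N * (2 - r) + \<gamma> * r"
  define d where "d = 2 - r"
  define e where "e = s - r"
  have D: "D > 0" unfolding D_def using assms by (intro add_pos_pos mult_pos_pos) auto
  have de: "d > 0" "e > 0" "r > 0" "s > 0" unfolding d_def e_def using assms by auto
  have "1 - \<theta> = (s * D - r * (N * (2 - s) + \<gamma> * s)) / (s * D)"
    unfolding \<theta>_def D_def[symmetric] using D de by (simp add: diff_divide_distrib)
  also have "s * D - r * (N * (2 - s) + \<gamma> * s) = 2 * N * e" unfolding D_def e_def by (simp add: algebra_simps)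
  finally have 1: "1 - \<theta> = 2 * N * e / (s * D)" .
  then have p: "2 / (1 - \<theta>) = s * D / (N * e)" by simp
  have "0 < 1 - \<theta>" unfolding 1 using assms D de by simp
  then show "\<theta> < 1" by simp
  have "(s - r) / ((2 - r) * s) * (2 / (1 - \<theta>)) = D / (N * d)"
    unfolding p d_def[symmetric] e_def[symmetric] using assms(2) D de by (simp add: field_simps)
  also have "\<dots> = 1 + \<gamma> / (N * ((2 - r) / r))"
    unfolding D_def d_def[symmetric] using assms(2) de by (simp add: field_simps)
  finally show "(s - r) / ((2 - r) * s) * (2 / (1 - \<theta>)) = 1 + \<gamma> / (N * ((2 - r) / r))" .
  have "(2 - s) / ((2 - r) * s) - \<theta> / r = ((2 - s) * D - d * (N * (2 - s) + \<gamma> * s)) / (d * s * D)"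
  proof -
    have "\<theta> / r = (N * (2 - s) + \<gamma> * s) / (s * D)" unfolding \<theta>_def D_def[symmetric] using de by simp
    moreover have "a / (d * s) - b / (s * D) = (a * D - d * b) / (d * s * D)" for a b
      using D de by (simp add: diff_divide_distrib)
    ultimately show ?thesis unfolding d_def by simp
  qed
  also have "(2 - s) * D - d * (N * (2 - s) + \<gamma> * s) = - (2 * \<gamma> * e)" unfolding D_def d_def e_def by (simp add: algebra_simps)
  finally have "(2 - s) / ((2 - r) * s) - \<theta> / r = - (2 * \<gamma> * e) / (d * s * D)" .
  then show "((2 - s) / ((2 - r) * s) - \<theta> / r) * (2 / (1 - \<theta>)) = - (2 / r * (\<gamma> / (N * ((2 - r) / r))))"
    unfolding p by (simp only: d_def[symmetric]) (use assms(2) D de in \<open>simp add: field_simps\<close>)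
qed

text \<open>\<theta> is the Hoelder exponent between r and 2, so the power of the L^r norm cancels
  and only the squared L^2 norm remains.\<close>

lemma exponent_high_frequency:
  fixes r s :: real
  defines "\<theta> \<equiv> (r * (2 - s)) / (s * (2 - r))"
  assumes "1 < r" "r < s" "s \<le> 2"
  shows "\<theta> < 1"
    and "((2 - s) / ((2 - r) * s) - \<theta> / r) * (2 / (1 - \<theta>)) = 0"
    and "(s - r) / ((2 - r) * s) * (2 / (1 - \<theta>)) = 1"
proof -
  define d where "d = 2 - r"
  define e where "e = s - r"
  have de: "d > 0" "e > 0" "r > 0" "s > 0" unfolding d_def e_def using assms by auto
  have "1 - \<theta> = (s * d - r * (2 - s)) / (s * d)"
    unfolding \<theta>_def d_def[symmetric] using de by (simp add: diff_divide_distrib)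
  also have "s * d - r * (2 - s) = 2 * e" unfolding d_def e_def by (simp add: algebra_simps)
  finally have 1: "1 - \<theta> = 2 * e / (s * d)" .
  have "0 < 1 - \<theta>" unfolding 1 using de by simp
  then show "\<theta> < 1" by simp
  have p: "2 / (1 - \<theta>) = s * d / e" using 1 by simp
  show "(s - r) / ((2 - r) * s) * (2 / (1 - \<theta>)) = 1"
    unfolding p d_def[symmetric] e_def[symmetric] using de by simp
  have "(2 - s) / ((2 - r) * s) - \<theta> / r = 0" unfolding \<theta>_def using de d_def by (simp add: field_simps)
  then show "((2 - s) / ((2 - r) * s) - \<theta> / r) * (2 / (1 - \<theta>)) = 0" by simp
qed

theorem corollary4p7:
  fixes J :: "real ^ 'n \<Rightarrow> real" and \<gamma> c\<^sub>0 r s :: real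
  assumes "J \<in> borel_measurable lebesgue"
    and "\<And>z. z \<noteq> 0 \<Longrightarrow> J z \<ge> 0"
    and "\<And>x y. x \<noteq> 0 \<Longrightarrow> y \<noteq> 0 \<Longrightarrow> norm x = norm y \<Longrightarrow> J x = J y"
    and "\<exists>\<delta>>0. \<forall>z. 0 < norm z \<and> norm z < \<delta> \<longrightarrow> J z > 0"
    and "(\<integral>\<^sup>+z. ennreal (J z * min ((norm z)\<^sup>2) 1) \<partial>lebesgue) < \<infinity>"
    and "0 < \<gamma>" and "\<gamma> \<le> 2" and "c\<^sub>0 > 0"
    and "\<And>\<xi>. norm \<xi> \<le> 1 \<Longrightarrow> levy_symbol J \<xi> \<ge> c\<^sub>0 * norm \<xi> powr \<gamma>"
    and "1 < r" and "r < s" and "s \<le> 2"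
  shows "let N = real CARD('n);
             \<theta>\<^sub>1 = (r * (N * (2 - s) + \<gamma> * s)) / (s * (N * (2 - r) + \<gamma> * r));
             \<theta>\<^sub>2 = (r * (2 - s)) / (s * (2 - r))
         in \<exists>c>0. \<forall>z \<in> form_domain J \<inter> Lp_space r. \<not> (AE x in lebesgue. z x = 0) \<longrightarrow>
              enn2real (dirichlet_form J z) \<ge>
                c * min ((Lp_norm s z * Lp_norm r z powr (- \<theta>\<^sub>1)) powr (2 / (1 - \<theta>\<^sub>1)))
                        ((Lp_norm s z * Lp_norm r z powr (- \<theta>\<^sub>2)) powr (2 / (1 - \<theta>\<^sub>2)))"
proof -
  obtain J' where J' [measurable]: "J' \<in> borel_measurable borel" and JJ': "AE z in lborel. J z = J' z"
    using completion_ex_borel_measurable_real[OF assms(1)] by auto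
  \<comment> \<open>The Borel representative may be negative on a null set; the maximum makes the
    kernel nonnegative everywhere.\<close>
  define H where "H z = max 0 (J' z)" for z
  have H [measurable]: "H \<in> borel_measurable borel" unfolding H_def by measurable
  \<comment> \<open>\<open>J 0\<close> may be negative, so the origin is discarded as a null set as
    well.\<close>
  have JH: "AE z in lborel. J z = H z"
    using JJ' AE_lborel_singleton[of 0] by eventually_elim (use assms(2) in \<open>fastforce simp: H_def\<close>)
  have Hi: "integrable lborel (\<lambda>z. H z * min ((norm z)\<^sup>2) 1)"
  proof (rule integrableI_nonneg)
    have "(\<integral>\<^sup>+z. ennreal (H z * min ((norm z)\<^sup>2) 1) \<partial>lborel) = (\<integral>\<^sup>+z. ennreal (J z * min ((norm z)\<^sup>2) 1) \<partial>lborel)"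
      by (rule nn_integral_cong_AE) (use JH in eventually_elim, simp)
    also have "\<dots> < \<infinity>" using assms(5) by (simp add: nn_integral_completion)
    finally show "(\<integral>\<^sup>+z. ennreal (H z * min ((norm z)\<^sup>2) 1) \<partial>lborel) < \<infinity>" .
  qed (auto simp: H_def)
  have symbol: "levy_symbol J \<xi> = (LINT z|lborel. (1 - cos (z \<bullet> \<xi>)) * H z)" for \<xi>
    unfolding levy_symbol_def
  proof (rule lebesgue_integral_eq_lborel)
    have "(\<lambda>z. 1 - cos (z \<bullet> \<xi>)) \<in> borel_measurable lebesgue"
      by (rule measurable_completion) measurable
    then show "(\<lambda>z. (1 - cos (z \<bullet> \<xi>)) * J z) \<in> borel_measurable lebesgue" using assms(1) by (rule borel_measurable_times)
    show "AE z in lborel. (1 - cos (z \<bullet> \<xi>)) * J z = (1 - cos (z \<bullet> \<xi>)) * H z"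
      using JH by eventually_elim simp
  qed measurable
  obtain \<delta> where \<delta>: "\<delta> > 0" "\<And>z. 0 < norm z \<Longrightarrow> norm z < \<delta> \<Longrightarrow> J z > 0" using assms(4) by blast
  have "AE z in lborel. 0 < norm z \<and> norm z < \<delta> \<longrightarrow> 0 < H z"
    using JH
  proof eventually_elim
    case (elim z)
    show ?case using \<delta>(2)[of z] unfolding elim by blast
  qed
  then obtain K b where K: "integrable lborel K" "\<And>z. 0 \<le> K z" "\<And>z. K z \<le> H z" and b: "0 < b"
    "\<And>\<xi>. norm \<xi> \<le> 1 \<Longrightarrow> b * norm \<xi> powr \<gamma> \<le> (LINT z|lborel. (1 - cos (z \<bullet> \<xi>)) * K z)"
    "\<And>\<xi>. 1 \<le> norm \<xi> \<Longrightarrow> b \<le> (LINT z|lborel. (1 - cos (z \<bullet> \<xi>)) * K z)"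
    using truncated_kernel[OF H _ Hi \<delta>(1) _ assms(7,8)] assms(9) unfolding symbol by (auto simp: H_def)
  have KJ: "AE z in lborel. K z \<le> J z" using JH by eventually_elim (use K(3) in auto)
  define N where "N = real CARD('n)"
  define \<theta>\<^sub>1 where "\<theta>\<^sub>1 = (r * (N * (2 - s) + \<gamma> * s)) / (s * (N * (2 - r) + \<gamma> * r))"
  define \<theta>\<^sub>2 where "\<theta>\<^sub>2 = (r * (2 - s)) / (s * (2 - r))"
  define n where "n = N * ((2 - r) / r)"
  have N: "N > 0" unfolding N_def by simp
  have n: "n > 0" unfolding n_def using N assms(10-12) by simp
  define v where "v = unit_ball_vol (DIM(real ^ 'n))"
  have v: "v > 0" unfolding v_def by simp
  \<comment> \<open>The averaging density is bounded by R^N / v; its power (2 - r) / r gives R^n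
    times this constant, the 2 being that of \<open>form_le_Lr_norm\<close>.\<close>
  define C\<^sub>2 where "C\<^sub>2 = 2 * v powr (- ((2 - r) / r))"
  \<comment> \<open>The constant of \<open>optimise_scale\<close> with
    \<open>C\<^sub>1 = 2 / b\<close>, where the 2 undoes the factor 1/2 in the Dirichlet form. It is
    fixed before z is chosen, as K and b depend on J only.\<close>
  define c where "c = min 1 ((2 * C\<^sub>2) powr (- (\<gamma> / n))) / (2 * (2 / b))"
  have C2: "C\<^sub>2 > 0" unfolding C\<^sub>2_def using v by simp
  have c: "c > 0" unfolding c_def using b C2 by simp
  have main: "c * min ((Lp_norm s z * Lp_norm r z powr (- \<theta>\<^sub>1)) powr (2 / (1 - \<theta>\<^sub>1)))
                      ((Lp_norm s z * Lp_norm r z powr (- \<theta>\<^sub>2)) powr (2 / (1 - \<theta>\<^sub>2))) \<le> enn2real (dirichlet_form J z)"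
    if z: "z \<in> form_domain J" "z \<in> Lp_space r" and nz: "\<not> (AE x in lebesgue. z x = 0)" for z
  proof -
    have zm: "z \<in> borel_measurable lebesgue" using z(2) unfolding Lp_space_def by simp
    then obtain f where f [measurable]: "f \<in> borel_measurable borel" and zf: "AE x in lborel. z x = f x"
      using completion_ex_borel_measurable_real[OF zm] by auto
    have zp: "(LINT x|lebesgue. \<bar>z x\<bar> powr p) = (LINT x|lborel. \<bar>f x\<bar> powr p)"
      "integrable lebesgue (\<lambda>x. \<bar>z x\<bar> powr p) \<longleftrightarrow> integrable lborel (\<lambda>x. \<bar>f x\<bar> powr p)" for p
    proof -
      have m: "(\<lambda>x. \<bar>z x\<bar> powr p) \<in> borel_measurable lebesgue" using zm by measurable
      have m': "(\<lambda>x. \<bar>f x\<bar> powr p) \<in> borel_measurable borel" by measurable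
      have e: "AE x in lborel. \<bar>z x\<bar> powr p = \<bar>f x\<bar> powr p" using zf by eventually_elim simp
      show "(LINT x|lebesgue. \<bar>z x\<bar> powr p) = (LINT x|lborel. \<bar>f x\<bar> powr p)"
        "integrable lebesgue (\<lambda>x. \<bar>z x\<bar> powr p) \<longleftrightarrow> integrable lborel (\<lambda>x. \<bar>f x\<bar> powr p)"
        by (rule lebesgue_integral_eq_lborel[OF m m' e], rule lebesgue_integrable_eq_lborel[OF m m' e])
    qed
    have fr: "integrable lborel (\<lambda>x. \<bar>f x\<bar> powr r)" "integrable lborel (\<lambda>x. \<bar>f x\<bar> powr 2)"
      using z unfolding form_domain_def Lp_space_def mem_Collect_eq zp(2) by blast+
    have pow2: "\<bar>t\<bar> powr 2 = t\<^sup>2" for t :: real by (cases "t = 0") auto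
    have f2: "integrable lborel (\<lambda>x. (f x)\<^sup>2)" using fr(2) by (simp add: pow2)
    define X where "X = (LINT x|lborel. \<bar>f x\<bar> powr r)"
    define A where "A = (LINT x|lborel. \<bar>f x\<bar> powr 2)"
    define Y where "Y = (LINT x|lborel. \<bar>f x\<bar> powr s)"
    have pos: "0 < (LINT x|lborel. \<bar>f x\<bar> powr p)" if p: "integrable lborel (\<lambda>x. \<bar>f x\<bar> powr p)" for p
    proof (rule ccontr)
      assume "\<not> 0 < (LINT x|lborel. \<bar>f x\<bar> powr p)"
      then have "(LINT x|lborel. \<bar>f x\<bar> powr p) = 0" by (intro antisym integral_nonneg_AE) (simp_all add: not_less)
      then have "AE x in lborel. \<bar>f x\<bar> powr p = 0" using integral_nonneg_eq_0_iff_AE[OF p] by simp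
      with zf have "AE x in lborel. z x = 0" by eventually_elim simp
      then show False using nz AE_completion by blast
    qed
    have X: "X > 0" and A: "A > 0" unfolding X_def A_def by (intro pos fr)+
    have Y0: "0 \<le> Y" unfolding Y_def by simp
    have Y: "Y \<le> X powr ((2 - s) / (2 - r)) * A powr ((s - r) / (2 - r))"
      unfolding X_def A_def Y_def
      by (rule Lp_interpolation[OF _ assms(11,12) fr(1) pos[OF fr(1)] fr(2) pos[OF fr(2)]]) simp
    let ?E = "LINT p|(lborel \<Otimes>\<^sub>M lborel). (f (fst p) - f (snd p))\<^sup>2 * K (fst p - snd p)"
    have "ennreal (?E / 2) \<le> dirichlet_form J z" by (rule dirichlet_form_ge[OF K(1,2) KJ f f2 zf])
    \<comment> \<open>Finiteness matters: \<open>enn2real\<close> sends infinity to 0 and is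
      monotone only below it.\<close>
    moreover have "dirichlet_form J z < \<infinity>" using z unfolding form_domain_def by simp
    ultimately have "enn2real (ennreal (?E / 2)) \<le> enn2real (dirichlet_form J z)" by (intro enn2real_mono) auto
    then have E: "?E \<le> 2 * enn2real (dirichlet_form J z)" using K(2) by (subst (asm) enn2real_ennreal) auto
    \<comment> \<open>This is the case s = 2: A is the squared L^2 norm and
      \<open>X powr (2 / r)\<close> the squared L^r norm. The two estimates after it bring in s by
      interpolation.\<close>
    have "c * min A (A * (A / X powr (2 / r)) powr (\<gamma> / n)) \<le> enn2real (dirichlet_form J z)"
      unfolding c_def
    proof (rule optimise_scale)
      fix R :: real assume R: "0 < R" "R \<le> 1"
      have "A \<le> R powr (-\<gamma>) / b * ?E + 2 * (R ^ DIM(real ^ 'n) / v) powr ((2 - r) / r) * X powr (2 / r)"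
        using Nash_inequality[OF K(1,2) b(1) assms(6,7) b(2,3) f f2 assms(10) _ fr(1) pos[OF fr(1)] R] assms(10-12)
        unfolding A_def X_def pow2 v_def by simp
      also have "2 * (R ^ DIM(real ^ 'n) / v) powr ((2 - r) / r) = C\<^sub>2 * R powr n"
        unfolding C\<^sub>2_def n_def N_def using R v by (simp add: powr_divide powr_minus_divide powr_realpow[symmetric] powr_powr)
      also have "R powr (-\<gamma>) / b * ?E \<le> R powr (-\<gamma>) / b * (2 * enn2real (dirichlet_form J z))"
        using E b by (intro mult_left_mono) auto
      finally show "A \<le> R powr (-\<gamma>) * (2 / b) * enn2real (dirichlet_form J z) + C\<^sub>2 * R powr n * X powr (2 / r)"
        by simp
    qed (use A X C2 b n assms(6) in auto)
    moreover have "(Lp_norm s z * Lp_norm r z powr (- \<theta>\<^sub>1)) powr (2 / (1 - \<theta>\<^sub>1)) \<le> A * (A / X powr (2 / r)) powr (\<gamma> / n)"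
    proof -
      note e = exponent_low_frequency[OF N assms(6,10-12), folded \<theta>\<^sub>1_def n_def]
      have "(Lp_norm s z * Lp_norm r z powr (- \<theta>\<^sub>1)) powr (2 / (1 - \<theta>\<^sub>1)) \<le> X powr (- (2 / r * (\<gamma> / n))) * A powr (1 + \<gamma> / n)"
        unfolding Lp_norm_def zp X_def[symmetric] Y_def[symmetric] e(2,3)[symmetric]
        by (rule norm_ratio_le[OF X A Y0 Y assms(10,11) e(1)])
      also have "\<dots> = A * (A / X powr (2 / r)) powr (\<gamma> / n)"
        using A X by (simp add: powr_add powr_divide powr_powr powr_minus_divide)
      finally show ?thesis .
    qed
    moreover have "(Lp_norm s z * Lp_norm r z powr (- \<theta>\<^sub>2)) powr (2 / (1 - \<theta>\<^sub>2)) \<le> A"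
    proof -
      note e = exponent_high_frequency[OF assms(10-12), folded \<theta>\<^sub>2_def]
      have "(Lp_norm s z * Lp_norm r z powr (- \<theta>\<^sub>2)) powr (2 / (1 - \<theta>\<^sub>2)) \<le> X powr 0 * A powr 1"
        unfolding Lp_norm_def zp X_def[symmetric] Y_def[symmetric]
        using norm_ratio_le[OF X A Y0 Y assms(10,11) e(1)] unfolding e(2,3) .
      then show ?thesis using A X by simp
    qed
    ultimately show ?thesis
      using c by (smt (verit) mult_left_mono min_def)
  qed
  show ?thesis
    unfolding Let_def N_def[symmetric] \<theta>\<^sub>1_def[symmetric] \<theta>\<^sub>2_def[symmetric]
    using c main by (intro exI[of _ c]) auto
qed

end
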